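(* Let $R>0$ and $\theta\in(0,\pi)$. There is a sequence of initial perturbations $\{\boldsymbol{\phi}_n\}_{n=1}^\infty\subset H^4(I_{\theta R})$ such that each $\boldsymbol{\phi}_n$ satisfies (A1), (A2) and (A3) (stated in the context, with $\boldsymbol{\varphi}_0=\boldsymbol{\phi}_n$) and the solution $\boldsymbol{x}_n={}^t(x_{n,1},x_{n,2},x_{n,3})$ of problem (P) (stated in the context) with initial datum $\boldsymbol{x}^R_0+\boldsymbol{\phi}_n$ satisfies $$|x_{n,3}(s,t)-x^R_3(s,t)|=\Big(\frac{2\pi n}{R\theta}\Big)t$$ for all $s\in I_{\theta R}$ and $t\ge0$, where $x^R_3$ is the third component of $\boldsymbol{x}^R$.
   Context: Notation. Subscripts $s,t$ denote differentiation; $\times$ and $\cdot$ are the cross and inner products in $\mathbf{R}^3$; for $\ell>0$, $I_\ell=(0,\ell)$. $H^m$ is the usual $L^2$-based Sobolev space; a vector-valued function belongs to a function space if each component does. Values of functions and their derivatives at endpoints are traces. Given $R>0$ and $\theta$, put $L=\theta R$, $\boldsymbol{e}_2={}^t(0,1,0)$, $\boldsymbol{b}={}^t(-\sin\theta,\cos\theta,0)$, $$\boldsymbol{x}^R(s,t)={}^t\big(R\cos(\tfrac sR),R\sin(\tfrac sR),\tfrac tR\big),\qquad \boldsymbol{x}^R_0(s)={}^t\big(R\cos(\tfrac sR),R\sin(\tfrac sR),0\big)$$ (the arc-shaped filament and its initial state). Problem (P), for the unknown $\boldsymbol{x}(s,t)\in\mathbf{R}^3$: $$\boldsymbol{x}_t=\boldsymbol{x}_s\times\boldsymbol{x}_{ss}\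 (s\in I_{\theta R},\,t>0),\quad \boldsymbol{x}(s,0)=\boldsymbol{x}^R_0(s)+\boldsymbol{\varphi}_0(s)\ (s\in I_{\theta R}),\quad \boldsymbol{x}_s(0,t)=\boldsymbol{e}_2,\ \boldsymbol{x}_s(\theta R,t)=\boldsymbol{b}\ (t>0).$$ For $\boldsymbol{\varphi}_0$ satisfying (A1)–(A3) below, "the solution" is the unique time-global solution in the class $\boldsymbol{x}\in\bigcap_{j=0}^{2}C^j([0,\infty);H^{4-2j}(I_{\theta R}))$, $\boldsymbol{x}_s\in L^\infty(0,\infty;H^3(I_{\theta R}))$. Assumptions on $\boldsymbol{\varphi}_0\in H^4(I_{\theta R})$: (A1) $|\boldsymbol{x}^R_{0s}(s)+\boldsymbol{\varphi}_{0s}(s)|=1$ for all $s\in I_{\theta R}$. (A2) $\boldsymbol{x}_0:=\boldsymbol{x}^R_0+\boldsymbol{\varphi}_0$ satisfies the compatibility conditions up to order $1$: $\boldsymbol{x}_{0s}(0)=\boldsymbol{e}_2$, $\boldsymbol{x}_{0s}(\theta R)=\boldsymbol{b}$, and $\boldsymbol{x}_{0s}\times\boldsymbol{x}_{0sss}=\boldsymbol{0}$ at $s=0$ and at $s=\theta R$. (A3) $\boldsymbol{e}_2\cdot\boldsymbol{\varphi}_0(0)=\boldsymbol{b}\cdot\boldsymbol{\varphi}_0(\theta R)=0$. *)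

theory Defs
  imports "HOL-Analysis.Analysis"
begin

section \<open>Sobolev spaces on the interval \<open>(0, L)\<close>\<close>

text \<open>
  The value type is an arbitrary Euclidean space; since its norm is the Euclidean norm of the
  components and the Bochner integral is taken componentwise, a vector-valued function belongs to
  one of the spaces below iff each of its components does.
\<close>

definition L2_space :: "real \<Rightarrow> (real \<Rightarrow> 'a::euclidean_space) set" where
  "L2_space L = {f. f \<in> borel_measurable (lebesgue_on {0<..<L}) \<and>
                    integrable (lebesgue_on {0<..<L}) (\<lambda>s. (norm (f s))\<^sup>2)}"

definition test_function :: "real \<Rightarrow> (real \<Rightarrow> real) \<Rightarrow> bool" where
  "test_function L \<psi> \<longleftrightarrow>
     (\<forall>k s. ((deriv ^^ k) \<psi>) differentiable (at s)) \<and> closure {s. \<psi> s \<noteq> 0} \<subseteq> {0<..<L}"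

definition has_weak_deriv ::
    "real \<Rightarrow> nat \<Rightarrow> (real \<Rightarrow> 'a::euclidean_space) \<Rightarrow> (real \<Rightarrow> 'a) \<Rightarrow> bool" where
  "has_weak_deriv L k f g \<longleftrightarrow>
     (\<forall>\<psi>. test_function L \<psi> \<longrightarrow>
        integral\<^sup>L (lebesgue_on {0<..<L}) (\<lambda>s. (deriv ^^ k) \<psi> s *\<^sub>R f s)
        = (-1) ^ k *\<^sub>R integral\<^sup>L (lebesgue_on {0<..<L}) (\<lambda>s. \<psi> s *\<^sub>R g s))"

definition sobolev :: "real \<Rightarrow> nat \<Rightarrow> (real \<Rightarrow> 'a::euclidean_space) set" where
  "sobolev L m = {f \<in> L2_space L. \<forall>k\<le>m. \<exists>g\<in>L2_space L. has_weak_deriv L k f g}"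

text \<open>The weak derivative is determined only up to null sets; some version is chosen.\<close>

definition weak_deriv ::
    "real \<Rightarrow> nat \<Rightarrow> (real \<Rightarrow> 'a::euclidean_space) \<Rightarrow> real \<Rightarrow> 'a" where
  "weak_deriv L k f = (SOME g. g \<in> L2_space L \<and> has_weak_deriv L k f g)"

definition sobolev_norm :: "real \<Rightarrow> nat \<Rightarrow> (real \<Rightarrow> 'a::euclidean_space) \<Rightarrow> real" where
  "sobolev_norm L m f =
     sqrt (\<Sum>k\<le>m. integral\<^sup>L (lebesgue_on {0<..<L}) (\<lambda>s. (norm (weak_deriv L k f s))\<^sup>2))"

definition cont_rep :: "real \<Rightarrow> (real \<Rightarrow> 'a::euclidean_space) \<Rightarrow> real \<Rightarrow> 'a" where
  "cont_rep L f = (SOME g. continuous_on {0..L} g \<and> (AE s in lebesgue_on {0<..<L}. g s = f s))"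

text \<open>
  Pointwise values of the \<open>k\<close>-th derivative of a function of class \<open>H\<^sup>m\<close> with \<open>m > k\<close>: the weak
  derivative is then of class \<open>H\<^sup>1\<close> and so has exactly one representative continuous on the closed
  interval, whose values at \<open>0\<close> and \<open>L\<close> are the traces.
\<close>

definition sob_deriv ::
    "real \<Rightarrow> nat \<Rightarrow> (real \<Rightarrow> 'a::euclidean_space) \<Rightarrow> real \<Rightarrow> 'a" where
  "sob_deriv L k f = cont_rep L (weak_deriv L k f)"


section \<open>Functions of time with values in Sobolev spaces\<close>

text \<open>In this section \<open>u t\<close> is the function of \<open>s\<close> which \<open>u\<close> takes as value at time \<open>t\<close>.\<close>

definition C0_sobolev ::
    "real \<Rightarrow> nat \<Rightarrow> (real \<Rightarrow> real \<Rightarrow> 'a::euclidean_space) \<Rightarrow> bool" where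
  "C0_sobolev L m u \<longleftrightarrow>
     (\<forall>t\<ge>0. u t \<in> sobolev L m) \<and>
     (\<forall>t\<ge>0. ((\<lambda>\<tau>. sobolev_norm L m (\<lambda>s. u \<tau> s - u t s)) \<longlongrightarrow> 0) (at t within {0..}))"

definition sobolev_has_time_deriv ::
    "real \<Rightarrow> nat \<Rightarrow> (real \<Rightarrow> real \<Rightarrow> 'a::euclidean_space) \<Rightarrow> (real \<Rightarrow> real \<Rightarrow> 'a) \<Rightarrow> bool" where
  "sobolev_has_time_deriv L m u v \<longleftrightarrow>
     (\<forall>t\<ge>0. u t \<in> sobolev L m \<and> v t \<in> sobolev L m) \<and>
     (\<forall>t\<ge>0. ((\<lambda>\<tau>. sobolev_norm L m (\<lambda>s. (1 / (\<tau> - t)) *\<^sub>R (u \<tau> s - u t s) - v t s)) \<longlongrightarrow> 0)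
              (at t within {0..}))"

text \<open>The class \<open>C\<^sup>j([0,\<infinity>); H\<^sup>m(0,L))\<close>.\<close>

primrec Cj_sobolev ::
    "nat \<Rightarrow> real \<Rightarrow> nat \<Rightarrow> (real \<Rightarrow> real \<Rightarrow> 'a::euclidean_space) \<Rightarrow> bool" where
  "Cj_sobolev 0 L m u \<longleftrightarrow> C0_sobolev L m u"
| "Cj_sobolev (Suc j) L m u \<longleftrightarrow>
     C0_sobolev L m u \<and> (\<exists>v. sobolev_has_time_deriv L m u v \<and> Cj_sobolev j L m v)"

text \<open>
  The class \<open>L\<^sup>\<infinity>(0,\<infinity>; H\<^sup>m(0,L))\<close>: strongly measurable (almost everywhere a limit of simple functions)
  and essentially bounded.
\<close>

definition Linf_sobolev ::
    "real \<Rightarrow> nat \<Rightarrow> (real \<Rightarrow> real \<Rightarrow> 'a::euclidean_space) \<Rightarrow> bool" where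
  "Linf_sobolev L m u \<longleftrightarrow>
     (\<exists>S. (\<forall>n::nat. finite (S n ` {0<..}) \<and> S n ` {0<..} \<subseteq> sobolev L m \<and>
                    (\<forall>f. {t \<in> {0<..}. S n t = f} \<in> sets lebesgue)) \<and>
          (AE t in lebesgue_on {0<..}.
             (\<lambda>n. sobolev_norm L m (\<lambda>s. S n t s - u t s)) \<longlonglongrightarrow> 0)) \<and>
     (\<exists>C. AE t in lebesgue_on {0<..}. u t \<in> sobolev L m \<and> sobolev_norm L m (u t) \<le> C)"


section \<open>The vortex filament problem\<close>

definition e2 :: "real^3" where
  "e2 = vector [0, 1, 0]"

definition b_vec :: "real \<Rightarrow> real^3" where
  "b_vec \<theta> = vector [- sin \<theta>, cos \<theta>, 0]"

definition arc_filament :: "real \<Rightarrow> real \<Rightarrow> real \<Rightarrow> real^3" where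
  "arc_filament R s t = vector [R * cos (s / R), R * sin (s / R), t / R]"

definition arc_filament0 :: "real \<Rightarrow> real \<Rightarrow> real^3" where
  "arc_filament0 R s = vector [R * cos (s / R), R * sin (s / R), 0]"

definition cond_A1 :: "real \<Rightarrow> real \<Rightarrow> (real \<Rightarrow> real^3) \<Rightarrow> bool" where
  "cond_A1 R \<theta> \<phi> \<longleftrightarrow>
     (\<forall>s\<in>{0<..<\<theta> * R}. norm (sob_deriv (\<theta> * R) 1 (arc_filament0 R) s + sob_deriv (\<theta> * R) 1 \<phi> s) = 1)"

definition cond_A2 :: "real \<Rightarrow> real \<Rightarrow> (real \<Rightarrow> real^3) \<Rightarrow> bool" where
  "cond_A2 R \<theta> \<phi> \<longleftrightarrow>
     (let L = \<theta> * R; x0 = (\<lambda>s. arc_filament0 R s + \<phi> s) in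
        sob_deriv L 1 x0 0 = e2 \<and> sob_deriv L 1 x0 L = b_vec \<theta> \<and>
        cross3 (sob_deriv L 1 x0 0) (sob_deriv L 3 x0 0) = 0 \<and>
        cross3 (sob_deriv L 1 x0 L) (sob_deriv L 3 x0 L) = 0)"

definition cond_A3 :: "real \<Rightarrow> real \<Rightarrow> (real \<Rightarrow> real^3) \<Rightarrow> bool" where
  "cond_A3 R \<theta> \<phi> \<longleftrightarrow> e2 \<bullet> \<phi> 0 = 0 \<and> b_vec \<theta> \<bullet> \<phi> (\<theta> * R) = 0"

text \<open>
  \<open>x s t\<close> solves (P) with initial datum \<open>arc_filament0 R + \<phi>\<close>, in the class
  \<open>C([0,\<infinity>);H\<^sup>4) \<inter> C\<^sup>1([0,\<infinity>);H\<^sup>2) \<inter> C\<^sup>2([0,\<infinity>);L\<^sup>2)\<close> with \<open>x\<^sub>s \<in> L\<^sup>\<infinity>(0,\<infinity>;H\<^sup>3)\<close>.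
  The continuity clause says that each \<open>x(\<cdot>,t)\<close> is given by its continuous representative, so that
  the value \<open>x s t\<close> is meaningful for every \<open>s\<close>.
\<close>

definition solves_P :: "real \<Rightarrow> real \<Rightarrow> (real \<Rightarrow> real^3) \<Rightarrow> (real \<Rightarrow> real \<Rightarrow> real^3) \<Rightarrow> bool" where
  "solves_P R \<theta> \<phi> x \<longleftrightarrow>
     (let L = \<theta> * R in
        (\<forall>t\<ge>0. continuous_on {0..L} (\<lambda>s. x s t)) \<and>
        (\<forall>j\<le>2. Cj_sobolev j L (4 - 2 * j) (\<lambda>t s. x s t)) \<and>
        Linf_sobolev L 3 (\<lambda>t. weak_deriv L 1 (\<lambda>s. x s t)) \<and>
        (\<forall>s\<in>{0<..<L}. \<forall>t>0.
           ((\<lambda>\<tau>. x s \<tau>) has_vector_derivative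
              cross3 (sob_deriv L 1 (\<lambda>\<sigma>. x \<sigma> t) s) (sob_deriv L 2 (\<lambda>\<sigma>. x \<sigma> t) s)) (at t)) \<and>
        (\<forall>s\<in>{0<..<L}. x s 0 = arc_filament0 R s + \<phi> s) \<and>
        (\<forall>t>0. sob_deriv L 1 (\<lambda>\<sigma>. x \<sigma> t) 0 = e2 \<and>
               sob_deriv L 1 (\<lambda>\<sigma>. x \<sigma> t) L = b_vec \<theta>))"

text \<open>``The'' solution of (P): a solution with which every other solution in the class agrees.\<close>

definition is_the_solution ::
    "real \<Rightarrow> real \<Rightarrow> (real \<Rightarrow> real^3) \<Rightarrow> (real \<Rightarrow> real \<Rightarrow> real^3) \<Rightarrow> bool" where
  "is_the_solution R \<theta> \<phi> x \<longleftrightarrow>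
     solves_P R \<theta> \<phi> x \<and>
     (\<forall>y. solves_P R \<theta> \<phi> y \<longrightarrow> (\<forall>s\<in>{0<..<\<theta> * R}. \<forall>t\<ge>0. y s t = x s t))"

end

theory Submission
  imports Defs
begin

text \<open>
  The boundary conditions fix the tangent at both ends, but not how often the filament winds around in between.
  The arc of radius \<open>r\<^sub>n = R \<theta> / (\<theta> + 2 \<pi> n)\<close> and length \<open>\<theta> R\<close> runs through the angle \<open>\<theta> + 2 \<pi> n\<close>, so it has
  the same tangents at its ends as the given arc; it also has the same position at its ends up to a normal displacement,
  which is (A3). Along a circle of radius \<open>r\<close> the vector \<open>x\<^sub>s \<times> x\<^sub>s\<^sub>s\<close> is the constant \<open>1 / r\<close> times the vertical unit
  vector (\<open>circ_cross\<close>), so the circle moves upwards with speed \<open>1 / r\<close>. Hence the perturbation \<open>\<phi>\<^sub>n\<close> that replaces the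
  given arc by the one of radius \<open>r\<^sub>n\<close> produces a solution whose height differs from that of the given one by
  \<open>(1 / r\<^sub>n - 1 / R) t = (2 \<pi> n / (R \<theta>)) t\<close>.

  The substantial part is that this explicit solution is the only one in the class of the problem
  (\<open>smooth_solution_unique\<close>). For the difference \<open>w\<close> of an arbitrary solution and a smooth one, the energy
  \<open>E t\<close>, the square of the \<open>L\<^sup>2\<close> norm of \<open>w\<^sub>s\<^sub>s\<close>, satisfies \<open>E' \<le> K E\<close>; all terms with too many derivatives drop out by the
  antisymmetry of the cross product, the remaining ones can be integrated by parts onto the smooth solution
  (\<open>energy_estimate\<close>), and \<open>E\<close> vanishes by Gronwall's lemma. The regularity \<open>C\<^sup>1([0,\<infinity>); H\<^sup>2)\<close> is just what is needed to
  differentiate \<open>E\<close> (\<open>sqnorm_has_time_derivative\<close>).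

  For this computation the weak derivatives of the definition have to be related to classical calculus. In one
  dimension a function with an integrable weak derivative is the primitive of that derivative
  (\<open>has_weak_deriv_imp_prim\<close>), by the lemma of du Bois-Reymond, which rests on the fundamental lemma of the calculus
  of variations (\<open>fundamental_lemma\<close>) and finally on the existence of enough test functions. Consequently
  all derivatives of a Sobolev function below the top order are classical ones, continuous up to the boundary
  (\<open>sob_deriv\<close>, \<open>sob_deriv_has_vector_derivative\<close>), and integration by parts is possible with one absolutely
  continuous factor (\<open>integration_by_parts_prim\<close>).
\<close>

section \<open>Smooth functions of compact support\<close>

definition smooth :: "(real \<Rightarrow> real) \<Rightarrow> bool" where
  "smooth f \<longleftrightarrow> (\<forall>k s. ((deriv ^^ k) f) differentiable (at s))"

text \<open>
  A class of differentiable functions that is stable under differentiation consists of smooth functions;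
  so smoothness is never proved by computing the \<open>k\<close>-th derivative, only by exhibiting such a class.
\<close>

lemma smooth_coinduct:
  assumes "f \<in> S" and S: "\<And>f. f \<in> S \<Longrightarrow> (\<forall>s. f differentiable (at s)) \<and> deriv f \<in> S"
  shows "smooth f"
proof -
  have "(deriv ^^ k) f \<in> S" for k
    by (induction k) (use assms in auto)
  with S show ?thesis by (auto simp: smooth_def)
qed

lemma smooth_differentiable: "smooth f \<Longrightarrow> f differentiable (at s)"
  unfolding smooth_def by (metis funpow_0)

lemma smooth_deriv: "smooth f \<Longrightarrow> smooth (deriv f)"
  unfolding smooth_def by (metis comp_apply funpow_Suc_right)

lemma smooth_DERIV: "smooth f \<Longrightarrow> (f has_real_derivative deriv f s) (at s)"
  by (metis DERIV_deriv_iff_real_differentiable smooth_differentiable)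

lemma smoothI_deriv:
  assumes "\<And>s. (f has_real_derivative g s) (at s)" "smooth g"
  shows "smooth f"
proof -
  have "deriv f = g" using assms(1) by (auto intro!: DERIV_imp_deriv)
  then show ?thesis
    using assms by (intro smooth_coinduct[of f "insert f (Collect smooth)"])
      (auto simp: smooth_differentiable smooth_deriv real_differentiable_def intro: smooth_DERIV)
qed

lemma smooth_continuous_on: "smooth f \<Longrightarrow> continuous_on A f"
  by (meson DERIV_isCont continuous_at_imp_continuous_on smooth_DERIV)

text \<open>
  Smoothness of sums, products and affine reparametrizations is obtained in one stroke: this class contains
  all of them and is stable under differentiation, because the derivative of a product is again a sum of products.
\<close>

inductive_set smooth_algebra :: "(real \<Rightarrow> real) set" where
  "smooth f \<Longrightarrow> (\<lambda>x. f (c * x + d)) \<in> smooth_algebra"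
| "f \<in> smooth_algebra \<Longrightarrow> g \<in> smooth_algebra \<Longrightarrow> (\<lambda>x. f x + g x) \<in> smooth_algebra"
| "f \<in> smooth_algebra \<Longrightarrow> g \<in> smooth_algebra \<Longrightarrow> (\<lambda>x. f x * g x) \<in> smooth_algebra"

lemma smooth_const: "smooth (\<lambda>_. c)"
  by (rule smooth_coinduct[of _ "range (\<lambda>c _. c)"]) auto

lemma smooth_algebra_DERIV:
  "f \<in> smooth_algebra \<Longrightarrow> \<exists>f'\<in>smooth_algebra. \<forall>s. (f has_real_derivative f' s) (at s)"
proof (induction rule: smooth_algebra.induct)
  case (1 f c d)
  have "(\<lambda>x. (\<lambda>_. c) (c * x + d)) \<in> smooth_algebra"
    by (rule smooth_algebra.intros(1)[OF smooth_const])
  then have "(\<lambda>x. deriv f (c * x + d) * c) \<in> smooth_algebra"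
    by (rule smooth_algebra.intros(3)[OF smooth_algebra.intros(1)[OF smooth_deriv[OF 1]]])
  moreover have "((\<lambda>x. f (c * x + d)) has_real_derivative deriv f (c * s + d) * c) (at s)" for s
    by (rule DERIV_chain2[OF smooth_DERIV[OF 1]]) (auto intro!: derivative_eq_intros)
  ultimately show ?case by (intro bexI[of _ "\<lambda>x. deriv f (c * x + d) * c"] allI)
next
  case (2 f g)
  then obtain f' g' where "f' \<in> smooth_algebra" "g' \<in> smooth_algebra"
    "\<And>s. (f has_real_derivative f' s) (at s)" "\<And>s. (g has_real_derivative g' s) (at s)" by blast
  then show ?case
    by (intro bexI[of _ "\<lambda>x. f' x + g' x"]) (auto intro!: derivative_intros smooth_algebra.intros)
next
  case (3 f g)
  then obtain f' g' where "f' \<in> smooth_algebra" "g' \<in> smooth_algebra"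
    "\<And>s. (f has_real_derivative f' s) (at s)" "\<And>s. (g has_real_derivative g' s) (at s)" by blast
  then show ?case
    by (intro bexI[of _ "\<lambda>x. f' x * g x + g' x * f x"]) (auto intro!: derivative_intros smooth_algebra.intros 3(1,2))
qed

lemma smooth_algebra_smooth: "f \<in> smooth_algebra \<Longrightarrow> smooth f"
proof (erule smooth_coinduct, intro conjI allI)
  fix f s assume "f \<in> smooth_algebra"
  then obtain f' where f': "f' \<in> smooth_algebra" "\<And>s. (f has_real_derivative f' s) (at s)"
    using smooth_algebra_DERIV by blast
  then have "deriv f = f'" by (auto intro!: DERIV_imp_deriv)
  with f' show "f differentiable (at s)" "deriv f \<in> smooth_algebra"
    by (auto simp: real_differentiable_def)
qed

lemma smooth_affine: "smooth f \<Longrightarrow> smooth (\<lambda>x. f (c * x + d))"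
  and smooth_add: "smooth f \<Longrightarrow> smooth g \<Longrightarrow> smooth (\<lambda>x. f x + g x)"
  and smooth_mult: "smooth f \<Longrightarrow> smooth g \<Longrightarrow> smooth (\<lambda>x. f x * g x)"
proof -
  show "smooth f \<Longrightarrow> smooth (\<lambda>x. f (c * x + d))"
    by (rule smooth_algebra_smooth[OF smooth_algebra.intros(1)])
  have *: "f \<in> smooth_algebra" if "smooth f" for f
    using smooth_algebra.intros(1)[OF that, where c=1 and d=0] by simp
  show "smooth f \<Longrightarrow> smooth g \<Longrightarrow> smooth (\<lambda>x. f x + g x)"
    by (rule smooth_algebra_smooth[OF smooth_algebra.intros(2)[OF * *]])
  show "smooth f \<Longrightarrow> smooth g \<Longrightarrow> smooth (\<lambda>x. f x * g x)"
    by (rule smooth_algebra_smooth[OF smooth_algebra.intros(3)[OF * *]])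
qed

text \<open>
  The classical functions that vanish to infinite order at \<open>0\<close>. The polynomial factor in \<open>1 / x\<close> is there because
  it makes the family stable under differentiation.
\<close>

definition flat :: "real poly \<Rightarrow> real \<Rightarrow> real" where
  "flat p x = (if x > 0 then poly p (1 / x) * exp (- (1 / x)) else 0)"

lemma poly_mult_exp_neg_tendsto_0: "((\<lambda>u::real. poly p u * exp (- u)) \<longlongrightarrow> 0) at_top"
proof -
  have "((\<lambda>u::real. \<Sum>i\<le>degree p. coeff p i * (u ^ i / exp u)) \<longlongrightarrow> (\<Sum>i\<le>degree p. coeff p i * 0)) at_top"
    by (intro tendsto_intros tendsto_power_div_exp_0)
  then show ?thesis
    by (simp add: poly_altdef exp_minus field_simps sum_divide_distrib)
qed

lemma flat_DERIV: "(flat p has_real_derivative flat ([:0, 0, 1:] * (p - pderiv p)) x) (at x)"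
proof -
  consider "x > 0" | "x < 0" | "x = 0" by linarith
  then show ?thesis
  proof cases
    case 1
    have "((\<lambda>x. poly p (1 / x) * exp (- (1 / x))) has_real_derivative
        flat ([:0, 0, 1:] * (p - pderiv p)) x) (at x)"
      using 1 unfolding flat_def
      by (auto intro!: derivative_eq_intros DERIV_chain2[OF poly_DERIV] simp: field_simps power2_eq_square)
    then show ?thesis
      by (rule has_field_derivative_transform_within_open[where S="{0<..}"]) (use 1 in \<open>auto simp: flat_def\<close>)
  next
    case 2
    have "((\<lambda>x. 0) has_real_derivative flat ([:0, 0, 1:] * (p - pderiv p)) x) (at x)"
      using 2 by (simp add: flat_def)
    then show ?thesis
      by (rule has_field_derivative_transform_within_open[where S="{..<0}"]) (use 2 in \<open>auto simp: flat_def\<close>)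
  next
    case 3
    have "((\<lambda>h. flat p h / h) \<longlongrightarrow> 0) (at 0)"
    proof (rule filterlim_split_at)
      have "eventually (\<lambda>h. 0 = flat p h / h) (at_left (0::real))"
        using eventually_at_left_real[of "-1" 0, simplified] by (rule eventually_mono) (auto simp: flat_def)
      then show "((\<lambda>h. flat p h / h) \<longlongrightarrow> 0) (at_left 0)"
        by (rule Lim_transform_eventually[OF tendsto_const])
      have "((\<lambda>h. poly ([:0, 1:] * p) (inverse h) * exp (- inverse h)) \<longlongrightarrow> 0) (at_right (0::real))"
        by (rule filterlim_compose[OF poly_mult_exp_neg_tendsto_0 filterlim_inverse_at_top_right])
      moreover have "eventually (\<lambda>h. poly ([:0, 1:] * p) (inverse h) * exp (- inverse h) = flat p h / h) (at_right (0::real))"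
        using eventually_at_right_less by (rule eventually_mono) (auto simp: flat_def field_simps)
      ultimately show "((\<lambda>h. flat p h / h) \<longlongrightarrow> 0) (at_right 0)"
        by (rule Lim_transform_eventually)
    qed
    with 3 show ?thesis by (simp add: DERIV_def flat_def)
  qed
qed

lemma smooth_flat: "smooth (flat p)"
proof (rule smooth_coinduct[of _ "range flat"])
  fix f assume "f \<in> range flat"
  then obtain p where f: "f = flat p" by blast
  have "deriv f = flat ([:0, 0, 1:] * (p - pderiv p))"
    unfolding f using flat_DERIV by (auto intro!: DERIV_imp_deriv)
  then show "(\<forall>s. f differentiable (at s)) \<and> deriv f \<in> range flat"
    unfolding f using flat_DERIV real_differentiable_def by blast
qed auto

text \<open>
  The rescaling by \<open>Suc n\<close> lets the bumps converge to the indicator function of the interval while they stay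
  below \<open>1\<close>, so that dominated convergence applies.
\<close>

definition bump :: "real \<Rightarrow> real \<Rightarrow> nat \<Rightarrow> real \<Rightarrow> real" where
  "bump a b n x = flat [:1:] (real (Suc n) * (x - a)) * flat [:1:] (real (Suc n) * (b - x))"

lemma smooth_bump: "smooth (bump a b n)"
proof -
  have "smooth (\<lambda>x. flat [:1:] (real (Suc n) * x + - (real (Suc n) * a)) * flat [:1:] ((- real (Suc n)) * x + real (Suc n) * b))"
    by (intro smooth_mult smooth_affine smooth_flat)
  then show ?thesis unfolding bump_def by (simp add: algebra_simps)
qed

lemma bump_bounds: "0 \<le> bump a b n x" "bump a b n x \<le> 1"
  unfolding bump_def flat_def by (auto intro!: mult_le_one)

lemma bump_eq_0_iff: "bump a b n x = 0 \<longleftrightarrow> x \<notin> {a<..<b}"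
  unfolding bump_def flat_def by (auto simp: zero_less_mult_iff)

lemma bump_tendsto_indicator: "(\<lambda>n. bump a b n x) \<longlonglongrightarrow> indicator {a<..<b} x"
proof (cases "x \<in> {a<..<b}")
  case True
  have "(\<lambda>n. flat [:1:] (real (Suc n) * y)) \<longlonglongrightarrow> 1" if "y > 0" for y
  proof -
    have "(\<lambda>n. exp (- (inverse (real (Suc n)) * (1 / y)))) \<longlonglongrightarrow> exp (- (0 * (1 / y)))"
      by (intro tendsto_intros LIMSEQ_inverse_real_of_nat)
    moreover have "exp (- (inverse (real (Suc n)) * (1 / y))) = flat [:1:] (real (Suc n) * y)" for n
      using that by (simp add: flat_def zero_less_mult_iff) (simp add: field_simps)
    ultimately show ?thesis by simp
  qed
  from tendsto_mult[OF this this, of "x - a" "b - x"] True show ?thesis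
    by (simp add: bump_def)
next
  case False
  then have "bump a b n x = 0" for n using bump_eq_0_iff by blast
  then show ?thesis using False by simp
qed

lemma test_function_iff: "test_function L \<psi> \<longleftrightarrow> smooth \<psi> \<and> closure {s. \<psi> s \<noteq> 0} \<subseteq> {0<..<L}"
  by (simp add: test_function_def smooth_def)

lemma test_function_bump:
  assumes "0 < a" "a < b" "b < L"
  shows "test_function L (bump a b n)"
proof -
  have "{s. bump a b n s \<noteq> 0} = {a<..<b}" by (auto simp: bump_eq_0_iff)
  with assms show ?thesis by (auto simp: test_function_iff smooth_bump)
qed

text \<open>
  Off the closed support of a function, the function is locally zero, and so is its derivative.
\<close>

lemma test_function_deriv:
  assumes "test_function L \<psi>"
  shows "test_function L (deriv \<psi>)"
proof -
  have "deriv \<psi> s = 0" if "s \<notin> closure {s. \<psi> s \<noteq> 0}" for s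
  proof (rule DERIV_imp_deriv)
    show "(\<psi> has_real_derivative 0) (at s)"
      by (rule has_field_derivative_transform_within_open[of "\<lambda>_. 0" _ _ "- closure {s. \<psi> s \<noteq> 0}"])
        (use that closure_subset[of "{s. \<psi> s \<noteq> 0}"] in \<open>auto simp: open_Compl\<close>)
  qed
  then have "closure {s. deriv \<psi> s \<noteq> 0} \<subseteq> closure {s. \<psi> s \<noteq> 0}"
    by (intro closure_minimal) auto
  with assms show ?thesis by (auto simp: test_function_iff smooth_deriv)
qed

lemma test_function_eq_0: "test_function L \<psi> \<Longrightarrow> s \<notin> {0<..<L} \<Longrightarrow> \<psi> s = 0"
  using closure_subset[of "{s. \<psi> s \<noteq> 0}"] unfolding test_function_iff by blast

section \<open>The fundamental lemma of the calculus of variations\<close>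

abbreviation ivl :: "real \<Rightarrow> real measure" where
  "ivl L \<equiv> lebesgue_on {0<..<L}"

lemma finite_measure_ivl: "finite_measure (ivl L)"
  by (intro finite_measure_lebesgue_on lmeasurable_open) auto

lemma continuous_on_imp_measurable_ivl:
  assumes "continuous_on {0..L} f"
  shows "f \<in> borel_measurable (ivl L)"
  by (rule continuous_imp_measurable_on_sets_lebesgue) (auto intro: continuous_on_subset[OF assms])

lemma integrable_ivl_scaleR_continuous:
  fixes g :: "real \<Rightarrow> 'a::euclidean_space" and f :: "real \<Rightarrow> real"
  assumes "continuous_on {0..L} f" "integrable (ivl L) g"
  shows "integrable (ivl L) (\<lambda>s. f s *\<^sub>R g s)"
proof -
  obtain B where B: "\<And>s. s \<in> {0..L} \<Longrightarrow> \<bar>f s\<bar> \<le> B"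
    using compact_imp_bounded[OF compact_continuous_image[OF assms(1)]] by (fastforce simp: bounded_iff)
  show ?thesis
  proof (rule Bochner_Integration.integrable_bound)
    show "integrable (ivl L) (\<lambda>s. B *\<^sub>R g s)" using assms by simp
    show "(\<lambda>s. f s *\<^sub>R g s) \<in> borel_measurable (ivl L)"
      by (rule borel_measurable_scaleR[OF continuous_on_imp_measurable_ivl[OF assms(1)]
            borel_measurable_integrable[OF assms(2)]])
    show "AE s in ivl L. norm (f s *\<^sub>R g s) \<le> norm (B *\<^sub>R g s)"
    proof (rule AE_I2)
      fix s assume "s \<in> space (ivl L)"
      then have "\<bar>f s\<bar> \<le> \<bar>B\<bar>" using B[of s] by auto
      then show "norm (f s *\<^sub>R g s) \<le> norm (B *\<^sub>R g s)" by (auto intro: mult_right_mono)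
    qed
  qed
qed

lemma integrable_ivl_indicator:
  fixes f :: "real \<Rightarrow> 'a::euclidean_space"
  assumes "integrable (ivl L) f" "A \<in> sets lebesgue"
  shows "integrable (ivl L) (\<lambda>s. indicat_real A s *\<^sub>R f s)"
proof -
  have "integrable (ivl L) (\<lambda>s. indicat_real (A \<inter> {0<..<L}) s *\<^sub>R f s)"
    using assms by (intro integrable_mult_indicator) (auto simp: sets_restrict_space_iff)
  then show ?thesis
    by (rule Bochner_Integration.integrable_cong[THEN iffD1, rotated 2]) (auto simp: indicator_def)
qed

text \<open>
  The bumps turn the hypothesis into the vanishing of the integral of \<open>f\<close> over all intervals compactly contained
  in \<open>(0, L)\<close>; exhaustion gives all open intervals, a Dynkin argument all Borel sets, and completion all
  Lebesgue measurable sets. A function whose integrals all vanish is zero almost everywhere.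
\<close>

lemma fundamental_lemma:
  fixes f :: "real \<Rightarrow> 'a::euclidean_space"
  assumes f: "integrable (ivl L) f"
    and test: "\<And>\<psi>. test_function L \<psi> \<Longrightarrow> integral\<^sup>L (ivl L) (\<lambda>s. \<psi> s *\<^sub>R f s) = 0"
  shows "AE s in ivl L. f s = 0"
proof -
  have [measurable]: "f \<in> borel_measurable (ivl L)" using f by simp
  note int = integrable_ivl_indicator[OF f]
  have inner: "integral\<^sup>L (ivl L) (\<lambda>s. indicat_real {a<..<b} s *\<^sub>R f s) = 0" if "0 < a" "a < b" "b < L" for a b
  proof -
    have "(\<lambda>n. integral\<^sup>L (ivl L) (\<lambda>s. bump a b n s *\<^sub>R f s)) \<longlonglongrightarrow>
        integral\<^sup>L (ivl L) (\<lambda>s. indicat_real {a<..<b} s *\<^sub>R f s)"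
    proof (rule integral_dominated_convergence[where w="\<lambda>s. norm (f s)"])
      show "(\<lambda>s. bump a b n s *\<^sub>R f s) \<in> borel_measurable (ivl L)" for n
        by (rule borel_measurable_scaleR[OF continuous_on_imp_measurable_ivl[OF
              smooth_continuous_on[OF smooth_bump]] borel_measurable_integrable[OF f]])
      show "AE s in ivl L. norm (bump a b n s *\<^sub>R f s) \<le> norm (f s)" for n
        by (auto simp: bump_bounds intro!: mult_left_le_one_le)
      show "AE s in ivl L. (\<lambda>n. bump a b n s *\<^sub>R f s) \<longlonglongrightarrow> indicat_real {a<..<b} s *\<^sub>R f s"
        by (intro AE_I2 tendsto_intros bump_tendsto_indicator)
      show "(\<lambda>s. indicat_real {a<..<b} s *\<^sub>R f s) \<in> borel_measurable (ivl L)"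
        using int[of "{a<..<b}"] by simp
    qed (use f in simp)
    moreover have "integral\<^sup>L (ivl L) (\<lambda>s. bump a b n s *\<^sub>R f s) = 0" for n
      by (intro test test_function_bump that)
    ultimately show ?thesis by (simp add: LIMSEQ_const_iff)
  qed
  have outer: "integral\<^sup>L (ivl L) (\<lambda>s. indicat_real {a<..<b} s *\<^sub>R f s) = 0" for a b
  proof -
    let ?a = "\<lambda>n. max a 0 + inverse (real (Suc n))" and ?b = "\<lambda>n. min b L - inverse (real (Suc n))"
    have "(\<lambda>n. integral\<^sup>L (ivl L) (\<lambda>s. indicat_real {?a n<..<?b n} s *\<^sub>R f s)) \<longlonglongrightarrow>
        integral\<^sup>L (ivl L) (\<lambda>s. indicat_real {a<..<b} s *\<^sub>R f s)"
    proof (rule integral_dominated_convergence[where w="\<lambda>s. norm (f s)"])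
      show "(\<lambda>s. indicat_real {?a n<..<?b n} s *\<^sub>R f s) \<in> borel_measurable (ivl L)" for n
        using int[of "{?a n<..<?b n}"] by simp
      show "AE s in ivl L. norm (indicat_real {?a n<..<?b n} s *\<^sub>R f s) \<le> norm (f s)" for n
        by (auto simp: indicator_def)
      show "AE s in ivl L. (\<lambda>n. indicat_real {?a n<..<?b n} s *\<^sub>R f s) \<longlonglongrightarrow> indicat_real {a<..<b} s *\<^sub>R f s"
      proof (intro AE_I2 tendsto_intros)
        fix s assume s: "s \<in> space (ivl L)"
        have "eventually (\<lambda>n. indicat_real {?a n<..<?b n} s = indicat_real {a<..<b} s) sequentially"
        proof (cases "a < s \<and> s < b")
          case True
          have "?a \<longlonglongrightarrow> max a 0 + 0" "?b \<longlonglongrightarrow> min b L - 0"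
            by (intro tendsto_intros LIMSEQ_inverse_real_of_nat)+
          then have "eventually (\<lambda>n. ?a n < s) sequentially" "eventually (\<lambda>n. s < ?b n) sequentially"
            using True s by (auto intro: order_tendstoD)
          then show ?thesis by eventually_elim (use True in auto)
        next
          case False
          have "s \<notin> {?a n<..<?b n}" for n 
          proof -
            have "inverse (real (Suc n)) > 0" by simp
            then show ?thesis using False unfolding greaterThanLessThan_iff by linarith
          qed
          with False show ?thesis by auto
        qed
        then show "(\<lambda>n. indicat_real {?a n<..<?b n} s) \<longlonglongrightarrow> indicat_real {a<..<b} s"
          by (rule tendsto_eventually)
      qed
      show "(\<lambda>s. indicat_real {a<..<b} s *\<^sub>R f s) \<in> borel_measurable (ivl L)"
        using int[of "{a<..<b}"] by simp
    qed (use f in simp)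
    moreover have "integral\<^sup>L (ivl L) (\<lambda>s. indicat_real {?a n<..<?b n} s *\<^sub>R f s) = 0" for n
    proof (cases "?a n < ?b n")
      case True
      have "inverse (real (Suc n)) > 0" by simp
      then show ?thesis using True by (intro inner) linarith+
    next
      case False
      then have "{?a n<..<?b n} = {}" by (intro greaterThanLessThan_empty) linarith
      then show ?thesis by (simp only: indicator_def) simp
    qed
    ultimately show ?thesis by (simp add: LIMSEQ_const_iff)
  qed
  have borel: "integral\<^sup>L (ivl L) (\<lambda>s. indicat_real A s *\<^sub>R f s) = 0" if "A \<in> sets borel" for A
  proof -
    let ?G = "range (\<lambda>(a, b). {a<..<b::real})"
    have eq: "sets borel = sigma_sets UNIV ?G"
      by (subst borel_eq_box) (simp add: sets_measure_of box_real case_prod_beta')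
    have "Int_stable ?G"
    proof (rule Int_stableI_image, clarify)
      fix a b c d :: real
      show "\<exists>k\<in>UNIV. {a<..<b} \<inter> {c<..<d} = (case k of (a, b) \<Rightarrow> {a<..<b})"
        by (rule bexI[of _ "(max a c, min b d)"]) auto
    qed
    moreover have "?G \<subseteq> Pow UNIV" by simp
    moreover have "A \<in> sigma_sets UNIV ?G" using that eq by simp
    ultimately show ?thesis
    proof (induction rule: sigma_sets_induct_disjoint)
      case (basic A) then show ?case using outer by auto
    next
      case (compl A)
      then have A: "A \<in> sets lebesgue" using eq by auto
      have "integral\<^sup>L (ivl L) (\<lambda>s. indicat_real (UNIV - A) s *\<^sub>R f s)
          = integral\<^sup>L (ivl L) (\<lambda>s. indicat_real {0<..<L} s *\<^sub>R f s - indicat_real A s *\<^sub>R f s)"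
        by (rule Bochner_Integration.integral_cong) (auto simp: indicator_def)
      also have "\<dots> = 0"
        using compl.IH by (simp add: int A outer)
      finally show ?case .
    next
      case (union A)
      have [simp]: "A i \<in> sets lebesgue" for i
      proof -
        have "A i \<in> sets borel" using union(2) eq by blast
        then show ?thesis by simp
      qed
      have "(\<lambda>n. integral\<^sup>L (ivl L) (\<lambda>s. \<Sum>i<n. indicat_real (A i) s *\<^sub>R f s)) \<longlonglongrightarrow>
          integral\<^sup>L (ivl L) (\<lambda>s. indicat_real (\<Union>i. A i) s *\<^sub>R f s)"
      proof (rule integral_dominated_convergence[where w="\<lambda>s. norm (f s)"])
        have eq': "(\<Sum>i<n. indicat_real (A i) s *\<^sub>R f s) = indicat_real (\<Union>i<n. A i) s *\<^sub>R f s" for n s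
          by (subst indicator_UN_disjoint)
            (use \<open>disjoint_family A\<close> in \<open>auto simp: scaleR_sum_left disjoint_family_on_def\<close>)
        show "AE s in ivl L. norm (\<Sum>i<n. indicat_real (A i) s *\<^sub>R f s) \<le> norm (f s)" for n
          unfolding eq' by (auto simp: indicator_def)
        show "AE s in ivl L. (\<lambda>n. \<Sum>i<n. indicat_real (A i) s *\<^sub>R f s) \<longlonglongrightarrow> indicat_real (\<Union>i. A i) s *\<^sub>R f s"
          unfolding eq' by (intro AE_I2 tendsto_intros LIMSEQ_indicator_UN)
        show "(\<lambda>s. \<Sum>i<n. indicat_real (A i) s *\<^sub>R f s) \<in> borel_measurable (ivl L)" for n
          by (intro borel_measurable_sum borel_measurable_integrable int) simp
        show "(\<lambda>s. indicat_real (\<Union>i. A i) s *\<^sub>R f s) \<in> borel_measurable (ivl L)"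
          by (intro borel_measurable_integrable int) auto
      qed (use f in simp)
      moreover have "integral\<^sup>L (ivl L) (\<lambda>s. \<Sum>i<n. indicat_real (A i) s *\<^sub>R f s) = 0" for n
        using union by (subst Bochner_Integration.integral_sum) (auto intro: int)
      ultimately show ?case by (simp add: LIMSEQ_const_iff)
    qed simp
  qed
  interpret finite_measure "ivl L" by (rule finite_measure_ivl)
  show ?thesis
  proof (rule density_zero[OF f])
    fix A assume "A \<in> sets (ivl L)"
    then have A: "A \<in> sets lebesgue" by (auto simp: sets_restrict_space)
    then obtain S N N' where S: "A = S \<union> N" "N \<subseteq> N'" "N' \<in> null_sets lborel" "S \<in> sets lborel"
      by (rule sets_completionE)
    have "N' \<in> null_sets lebesgue" using S null_sets_completionI by blast
    then have "AE s in lebesgue. s \<notin> N'" by (rule AE_not_in)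
    then have "AE s in ivl L. s \<notin> N'" by (subst AE_restrict_space_iff) auto
    then have ae: "AE s in ivl L. indicat_real A s *\<^sub>R f s = indicat_real S s *\<^sub>R f s"
      by eventually_elim (use S in \<open>auto simp: indicator_def\<close>)
    have "integral\<^sup>L (ivl L) (\<lambda>s. indicat_real A s *\<^sub>R f s) = integral\<^sup>L (ivl L) (\<lambda>s. indicat_real S s *\<^sub>R f s)"
      using S A ae by (intro integral_cong_AE) (auto intro!: borel_measurable_integrable int)
    with borel[of S] S show "set_lebesgue_integral (ivl L) A f = 0"
      by (simp add: set_lebesgue_integral_def)
  qed
qed

lemma integrable_ivl_continuous:
  fixes f :: "real \<Rightarrow> 'a::euclidean_space"
  assumes "continuous_on {0..L} f"
  shows "integrable (ivl L) f"
proof -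
  obtain B where "\<forall>s\<in>{0..L}. norm (f s) \<le> B"
    using compact_imp_bounded[OF compact_continuous_image[OF assms]] by (auto simp: bounded_iff)
  then show ?thesis
    by (intro finite_measure.integrable_const_bound[OF finite_measure_ivl, where B=B]
        continuous_on_imp_measurable_ivl assms AE_I2) auto
qed

lemma measure_ivl: "0 < L \<Longrightarrow> measure (ivl L) (space (ivl L)) = L"
  by (simp add: measure_restrict_space)

lemma AE_ivl_neq: "AE r in ivl L. r \<noteq> (s::real)"
proof -
  have "AE r in lebesgue. r \<noteq> s"
    using AE_lborel_singleton[of s] by (rule AE_completion)
  then show ?thesis by (subst AE_restrict_space_iff) auto
qed

text \<open>
  This makes the value at an endpoint of a continuous representative independent of the representative,
  and so gives a meaning to traces.
\<close>

lemma continuous_on_AE_unique: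
  fixes f g :: "real \<Rightarrow> 'a::euclidean_space"
  assumes f: "continuous_on {0..L} f" and g: "continuous_on {0..L} g"
    and ae: "AE s in ivl L. f s = g s" and s: "s \<in> {0..L}" and L: "0 < L"
  shows "f s = g s"
proof -
  let ?C = "{s\<in>{0..L}. f s = g s}"
  have cl: "closed ?C"
    using continuous_closed_preimage_constant[OF continuous_on_diff[OF f g], of 0] by simp
  have "x \<in> ?C" if "x \<in> {0<..<L}" for x
  proof (rule mem_closed_if_AE_lebesgue_open[OF open_greaterThanLessThan[of 0 L] cl _ that])
    have "AE x in lebesgue. x \<in> {0<..<L} \<longrightarrow> f x = g x"
      using ae by (subst (asm) AE_restrict_space_iff) auto
    then show "AE x\<in>{0<..<L} in lebesgue. x \<in> ?C" by eventually_elim auto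
  qed
  then have "closure {0<..<L} \<subseteq> ?C"
    by (intro closure_minimal cl) auto
  with L s show ?thesis by auto
qed

section \<open>Primitives of integrable functions\<close>

text \<open>
  The primitive vanishing at \<open>0\<close>, written with an indicator function inside an integral over the fixed
  interval \<open>(0, L)\<close>: it is then defined for all real \<open>s\<close>, and dominated convergence and Fubini's theorem
  apply to it directly.
\<close>

definition prim :: "real \<Rightarrow> (real \<Rightarrow> 'a::euclidean_space) \<Rightarrow> real \<Rightarrow> 'a" where
  "prim L g s = integral\<^sup>L (ivl L) (\<lambda>r. indicat_real {..s} r *\<^sub>R g r)"

lemma prim_0 [simp]: "prim L g 0 = 0"
proof -
  have "prim L g 0 = integral\<^sup>L (ivl L) (\<lambda>r. 0)"
    unfolding prim_def by (rule Bochner_Integration.integral_cong) auto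
  then show ?thesis by simp
qed

lemma prim_L: "prim L g L = integral\<^sup>L (ivl L) g"
  unfolding prim_def by (rule Bochner_Integration.integral_cong) auto

lemma continuous_prim:
  assumes g: "integrable (ivl L) g"
  shows "continuous_on A (prim L g)"
proof (rule continuous_on_subset[OF _ subset_UNIV], unfold continuous_on_sequentially, safe)
  fix x :: "nat \<Rightarrow> real" and s assume x: "x \<longlonglongrightarrow> s"
  show "(prim L g \<circ> x) \<longlonglongrightarrow> prim L g s"
    unfolding prim_def o_def
  proof (rule integral_dominated_convergence[where w="\<lambda>s. norm (g s)"])
    show "AE r in ivl L. (\<lambda>n. indicat_real {..x n} r *\<^sub>R g r) \<longlonglongrightarrow> indicat_real {..s} r *\<^sub>R g r"
      using AE_ivl_neq[of s]
    proof eventually_elim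
      case (elim r)
      have "eventually (\<lambda>n. indicat_real {..x n} r = indicat_real {..s} r) sequentially"
      proof (cases "r < s")
        case True
        with x have "eventually (\<lambda>n. r < x n) sequentially" by (rule order_tendstoD)
        then show ?thesis by eventually_elim (use True in auto)
      next
        case False
        with elim have "s < r" by simp
        with x have "eventually (\<lambda>n. x n < r) sequentially" by (rule order_tendstoD)
        then show ?thesis by eventually_elim (use False elim in auto)
      qed
      then show ?case by (intro tendsto_intros tendsto_eventually)
    qed
    show "AE r in ivl L. norm (indicat_real {..x n} r *\<^sub>R g r) \<le> norm (g r)" for n
      by (auto simp: indicator_def)
  qed (auto intro!: borel_measurable_integrable integrable_ivl_indicator g)
qed

lemma norm_prim_diff:
  assumes g: "integrable (ivl L) g"
  shows "norm (prim L g s - prim L g s') \<le> integral\<^sup>L (ivl L) (\<lambda>r. norm (g r))"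
proof -
  have "prim L g s - prim L g s'
      = integral\<^sup>L (ivl L) (\<lambda>r. indicat_real {..s} r *\<^sub>R g r - indicat_real {..s'} r *\<^sub>R g r)"
    unfolding prim_def by (subst Bochner_Integration.integral_diff) (auto intro!: integrable_ivl_indicator g)
  also have "norm \<dots> \<le> integral\<^sup>L (ivl L) (\<lambda>r. norm (indicat_real {..s} r *\<^sub>R g r - indicat_real {..s'} r *\<^sub>R g r))"
    by (rule integral_norm_bound)
  also have "\<dots> \<le> integral\<^sup>L (ivl L) (\<lambda>r. norm (g r))"
    by (intro integral_mono Bochner_Integration.integrable_norm Bochner_Integration.integrable_diff
        integrable_ivl_indicator g) (auto simp: indicator_def)
  finally show ?thesis .
qed

lemma prim_cong_AE:
  assumes "integrable (ivl L) f" "integrable (ivl L) g" "AE s in ivl L. f s = g s"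
  shows "prim L f s = prim L g s"
  unfolding prim_def using assms
  by (intro integral_cong_AE borel_measurable_integrable integrable_ivl_indicator) (auto elim: AE_mp)

lemma prim_eq_integral:
  fixes g :: "real \<Rightarrow> 'a::euclidean_space"
  assumes g: "integrable (ivl L) g" and s: "s \<in> {0..L}"
  shows "prim L g s = integral {0..s} g"
proof -
  have "prim L g s = integral {0<..<L} (\<lambda>r. indicat_real {..s} r *\<^sub>R g r)"
    unfolding prim_def
    by (intro integral_unique[symmetric] has_integral_integral_lebesgue_on integrable_ivl_indicator g) auto
  also have "\<dots> = integral {0<..<L} (\<lambda>r. if r \<in> {..s} then g r else 0)"
    by (intro Henstock_Kurzweil_Integration.integral_cong) (auto simp: indicator_def)
  also have "\<dots> = integral ({0<..<L} \<inter> {..s}) g"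
    by (subst Henstock_Kurzweil_Integration.integral_restrict_Int) (simp add: Int_commute)
  also have "\<dots> = integral {0..s} g"
    by (rule integral_spike_set; rule negligible_subset[of "{0, s}"]) (use s in auto)
  finally show ?thesis .
qed

lemma prim_has_vector_derivative:
  fixes g :: "real \<Rightarrow> 'a::euclidean_space"
  assumes g: "continuous_on {0..L} g" and s: "s \<in> {0..L}"
  shows "(prim L g has_vector_derivative g s) (at s within {0..L})"
  by (rule has_vector_derivative_transform[OF s _ integral_has_vector_derivative[OF g s]])
    (rule prim_eq_integral[OF integrable_ivl_continuous[OF g]])

lemma prim_of_derivative:
  fixes F :: "real \<Rightarrow> 'a::euclidean_space"
  assumes d: "\<And>s. s \<in> {0..L} \<Longrightarrow> (F has_vector_derivative F' s) (at s within {0..L})"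
    and c: "continuous_on {0..L} F'" and s: "s \<in> {0..L}"
  shows "prim L F' s = F s - F 0"
proof -
  have "(F' has_integral (F s - F 0)) {0..s}"
    using s by (intro fundamental_theorem_of_calculus) (auto intro!: has_vector_derivative_within_subset[OF d])
  with prim_eq_integral[OF integrable_ivl_continuous[OF c] s] show ?thesis
    by (simp add: integral_unique)
qed

text \<open>
  Fubini's theorem on the triangle \<open>r \<le> s\<close>: the inner integral of \<open>f'\<close> over \<open>[r, L]\<close> is \<open>f L - f r\<close>.
\<close>

lemma integral_derivative_prim:
  fixes g :: "real \<Rightarrow> 'a::euclidean_space" and f f' :: "real \<Rightarrow> real"
  assumes d: "\<And>s. s \<in> {0..L} \<Longrightarrow> (f has_vector_derivative f' s) (at s within {0..L})"
    and c: "continuous_on {0..L} f'" and g: "integrable (ivl L) g" and L: "0 < L"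
  shows "integral\<^sup>L (ivl L) (\<lambda>s. f' s *\<^sub>R prim L g s) = integral\<^sup>L (ivl L) (\<lambda>r. (f L - f r) *\<^sub>R g r)"
proof -
  interpret finite_measure "ivl L" by (rule finite_measure_ivl)
  interpret P: pair_sigma_finite "ivl L" "ivl L" ..
  have f': "integrable (ivl L) f'" by (intro integrable_ivl_continuous c)
  have [measurable]: "f' \<in> borel_measurable (ivl L)" "g \<in> borel_measurable (ivl L)"
    using f' g by auto
  have id [measurable]: "(\<lambda>x. x) \<in> borel_measurable (ivl L)"
    using id_borel_measurable_lebesgue_on[of "{0<..<L}"] by (simp add: id_def)
  have [measurable]: "(\<lambda>(s, r). indicat_real {..s} r) \<in> borel_measurable (ivl L \<Otimes>\<^sub>M ivl L)"
  proof -
    have "(\<lambda>x. if snd x \<le> fst x then 1 else 0::real) \<in> borel_measurable (ivl L \<Otimes>\<^sub>M ivl L)"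
      by (intro measurable_If borel_measurable_le borel_measurable_const pred_sets2
          measurable_compose[OF measurable_fst id] measurable_compose[OF measurable_snd id])
    then show ?thesis by (simp add: case_prod_unfold indicator_def if_distrib cong: if_cong)
  qed
  have int: "integrable (ivl L \<Otimes>\<^sub>M ivl L) (\<lambda>(s, r). (indicat_real {..s} r * f' s) *\<^sub>R g r)"
  proof (rule Bochner_Integration.integrable_bound)
    show "integrable (ivl L \<Otimes>\<^sub>M ivl L) (\<lambda>(s, r). f' s *\<^sub>R g r)"
      by (intro P.Fubini_integrable) (auto intro!: Bochner_Integration.integrable_norm f' g)
    show "(\<lambda>(s, r). (indicat_real {..s} r * f' s) *\<^sub>R g r) \<in> borel_measurable (ivl L \<Otimes>\<^sub>M ivl L)"
      by measurable
  qed (auto simp: indicator_def)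
  have "integral\<^sup>L (ivl L) (\<lambda>s. f' s *\<^sub>R prim L g s)
      = integral\<^sup>L (ivl L) (\<lambda>s. integral\<^sup>L (ivl L) (\<lambda>r. (indicat_real {..s} r * f' s) *\<^sub>R g r))"
  proof (rule Bochner_Integration.integral_cong[OF refl])
    fix s
    have "f' s *\<^sub>R prim L g s = integral\<^sup>L (ivl L) (\<lambda>r. f' s *\<^sub>R (indicat_real {..s} r *\<^sub>R g r))"
      unfolding prim_def by (rule integral_scaleR_right[symmetric])
    then show "f' s *\<^sub>R prim L g s = integral\<^sup>L (ivl L) (\<lambda>r. (indicat_real {..s} r * f' s) *\<^sub>R g r)"
      by (simp only: scaleR_scaleR mult.commute)
  qed
  also have "\<dots> = integral\<^sup>L (ivl L) (\<lambda>r. integral\<^sup>L (ivl L) (\<lambda>s. (indicat_real {..s} r * f' s) *\<^sub>R g r))"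
    by (rule P.Fubini_integral[OF int, symmetric])
  also have "\<dots> = integral\<^sup>L (ivl L) (\<lambda>r. (f L - f r) *\<^sub>R g r)"
  proof (rule Bochner_Integration.integral_cong[OF refl])
    fix r assume "r \<in> space (ivl L)"
    then have r: "r \<in> {0<..<L}" by simp
    have "integral\<^sup>L (ivl L) (\<lambda>s. indicat_real {..s} r * f' s)
        = integral\<^sup>L (ivl L) (\<lambda>s. f' s - indicat_real {..<r} s *\<^sub>R f' s)"
      by (rule Bochner_Integration.integral_cong) (auto simp: indicator_def)
    also have "\<dots> = prim L f' L - integral\<^sup>L (ivl L) (\<lambda>s. indicat_real {..<r} s *\<^sub>R f' s)"
      by (subst Bochner_Integration.integral_diff) (use integrable_ivl_indicator[OF f', of "{..<r}"] f' in \<open>simp_all add: prim_L\<close>)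
    also have "integral\<^sup>L (ivl L) (\<lambda>s. indicat_real {..<r} s *\<^sub>R f' s) = prim L f' r"
      unfolding prim_def
    proof (intro integral_cong_AE borel_measurable_integrable integrable_ivl_indicator f')
      show "AE s in ivl L. indicat_real {..<r} s *\<^sub>R f' s = indicat_real {..r} s *\<^sub>R f' s"
        using AE_ivl_neq[of r] by eventually_elim (auto simp: indicator_def)
    qed auto
    also have "prim L f' L - prim L f' r = f L - f r"
      using r prim_of_derivative[OF d c, of r] prim_of_derivative[OF d c, of L] by simp
    finally have eq: "integral\<^sup>L (ivl L) (\<lambda>s. indicat_real {..s} r * f' s) = f L - f r" .
    show "integral\<^sup>L (ivl L) (\<lambda>s. (indicat_real {..s} r * f' s) *\<^sub>R g r) = (f L - f r) *\<^sub>R g r"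
    proof (cases "g r = 0")
      case False
      have "integrable (ivl L) (\<lambda>s. indicat_real {..s} r * f' s)"
      proof (rule Bochner_Integration.integrable_cong[THEN iffD2, OF refl])
        show "integrable (ivl L) (\<lambda>s. indicat_real {r..} s *\<^sub>R f' s)"
          by (intro integrable_ivl_indicator f') auto
      qed (auto simp: indicator_def)
      then show ?thesis by (simp add: eq)
    qed simp
  qed
  finally show ?thesis .
qed

text \<open>
  Only \<open>f\<close> has to be continuously differentiable. The function \<open>G\<close> is merely the primitive of an integrable function,
  that is, absolutely continuous; this is the regularity of the highest derivative that has a trace.
\<close>

lemma integration_by_parts_prim:
  fixes g :: "real \<Rightarrow> 'a::euclidean_space" and f f' :: "real \<Rightarrow> real"
  assumes d: "\<And>s. s \<in> {0..L} \<Longrightarrow> (f has_vector_derivative f' s) (at s within {0..L})"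
    and c: "continuous_on {0..L} f'" and g: "integrable (ivl L) g" and L: "0 < L"
    and G: "\<And>s. s \<in> {0..L} \<Longrightarrow> G s = G 0 + prim L g s"
  shows "integral\<^sup>L (ivl L) (\<lambda>s. f' s *\<^sub>R G s) + integral\<^sup>L (ivl L) (\<lambda>s. f s *\<^sub>R g s)
    = f L *\<^sub>R G L - f 0 *\<^sub>R G 0"
proof -
  have f: "continuous_on {0..L} f" by (meson continuous_on_vector_derivative d)
  have f': "integrable (ivl L) f'" by (intro integrable_ivl_continuous c)
  have "integral\<^sup>L (ivl L) (\<lambda>s. f' s *\<^sub>R G s) = integral\<^sup>L (ivl L) (\<lambda>s. f' s *\<^sub>R G 0 + f' s *\<^sub>R prim L g s)"
    by (rule Bochner_Integration.integral_cong[OF refl], subst G) (simp_all add: scaleR_add_right)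
  also have "\<dots> = prim L f' L *\<^sub>R G 0 + integral\<^sup>L (ivl L) (\<lambda>s. f' s *\<^sub>R prim L g s)"
    unfolding prim_L using f'
    by (subst Bochner_Integration.integral_add)
      (auto intro!: integrable_ivl_continuous continuous_intros c continuous_prim g)
  also have "integral\<^sup>L (ivl L) (\<lambda>s. f' s *\<^sub>R prim L g s) = integral\<^sup>L (ivl L) (\<lambda>r. f L *\<^sub>R g r - f r *\<^sub>R g r)"
    by (subst integral_derivative_prim[OF d c g L]) (auto simp: scaleR_diff_left)
  also have "\<dots> = f L *\<^sub>R prim L g L - integral\<^sup>L (ivl L) (\<lambda>s. f s *\<^sub>R g s)"
    unfolding prim_L
    by (subst Bochner_Integration.integral_diff) (auto intro!: integrable_ivl_scaleR_continuous f g)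
  also have "prim L f' L = f L - f 0"
    using L by (intro prim_of_derivative[OF d c]) auto
  finally show ?thesis
    using G[of L] L by (simp add: algebra_simps)
qed


section \<open>The space of square-integrable functions\<close>

lemma L2_space_integrable:
  assumes "f \<in> L2_space L" shows "integrable (ivl L) f"
proof (rule Bochner_Integration.integrable_bound[where f="\<lambda>s. 1 + (norm (f s))\<^sup>2"])
  show "integrable (ivl L) (\<lambda>s. 1 + (norm (f s))\<^sup>2)"
    using assms by (intro Bochner_Integration.integrable_add finite_measure.integrable_const finite_measure_ivl)
      (simp add: L2_space_def)
  have "norm (f s) \<le> 1 + (norm (f s))\<^sup>2" for s
    using sum_squares_bound[of "norm (f s)" 1] norm_ge_zero[of "f s"] by (simp only: power_one mult_1_right)
  then show "AE s in ivl L. norm (f s) \<le> norm (1 + (norm (f s))\<^sup>2)"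
    by (intro AE_I2) (metis abs_ge_self order_trans real_norm_def)
qed (use assms in \<open>simp add: L2_space_def\<close>)

lemma L2_space_scaleR: "f \<in> L2_space L \<Longrightarrow> (\<lambda>s. c *\<^sub>R f s) \<in> L2_space L"
  unfolding L2_space_def by (auto simp: power_mult_distrib)

lemma L2_space_add:
  assumes f: "f \<in> L2_space L" and g: "g \<in> L2_space L"
  shows "(\<lambda>s. f s + g s) \<in> L2_space L"
proof -
  have [measurable]: "f \<in> borel_measurable (ivl L)" "g \<in> borel_measurable (ivl L)"
    using f g by (auto simp: L2_space_def)
  have "integrable (ivl L) (\<lambda>s. (norm (f s + g s))\<^sup>2)"
  proof (rule Bochner_Integration.integrable_bound)
    show "integrable (ivl L) (\<lambda>s. 2 * (norm (f s))\<^sup>2 + 2 * (norm (g s))\<^sup>2)"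
      using f g by (auto simp: L2_space_def)
    have "(norm (f s + g s))\<^sup>2 \<le> 2 * (norm (f s))\<^sup>2 + 2 * (norm (g s))\<^sup>2" for s
    proof -
      have "(norm (f s + g s))\<^sup>2 \<le> (norm (f s) + norm (g s))\<^sup>2"
        by (intro power_mono norm_triangle_ineq) simp
      also have "\<dots> \<le> 2 * (norm (f s))\<^sup>2 + 2 * (norm (g s))\<^sup>2"
        using sum_squares_bound[of "norm (f s)" "norm (g s)"] by (simp add: power2_sum)
      finally show ?thesis .
    qed
    then show "AE s in ivl L. norm ((norm (f s + g s))\<^sup>2) \<le> norm (2 * (norm (f s))\<^sup>2 + 2 * (norm (g s))\<^sup>2)"
      by auto
  qed simp
  then show ?thesis by (simp add: L2_space_def)
qed

lemma L2_space_diff: "f \<in> L2_space L \<Longrightarrow> g \<in> L2_space L \<Longrightarrow> (\<lambda>s. f s - g s) \<in> L2_space L"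
  using L2_space_add[OF _ L2_space_scaleR[of g L "-1"], of f] by simp

lemma L2_space_continuous:
  assumes "continuous_on {0..L} f" shows "f \<in> L2_space L"
  unfolding L2_space_def
  by (auto intro!: continuous_on_imp_measurable_ivl integrable_ivl_continuous continuous_intros assms)

section \<open>Weak derivatives\<close>

lemma test_function_continuous_on: "test_function L \<psi> \<Longrightarrow> continuous_on A \<psi>"
  by (simp add: test_function_iff smooth_continuous_on)

lemma test_function_funpow: "test_function L \<psi> \<Longrightarrow> test_function L ((deriv ^^ k) \<psi>)"
  by (induction k) (auto intro: test_function_deriv)

lemma integrable_test:
  fixes g :: "real \<Rightarrow> 'a::euclidean_space"
  shows "test_function L \<psi> \<Longrightarrow> integrable (ivl L) g \<Longrightarrow> integrable (ivl L) (\<lambda>s. \<psi> s *\<^sub>R g s)"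
  by (intro integrable_ivl_scaleR_continuous test_function_continuous_on)

lemma test_function_has_vector_derivative:
  "test_function L \<psi> \<Longrightarrow> (\<psi> has_vector_derivative deriv \<psi> s) (at s within A)"
  unfolding test_function_iff
  by (metis smooth_DERIV has_vector_derivative_at_within has_real_derivative_iff_has_vector_derivative)

lemma has_weak_derivD:
  "has_weak_deriv L k f g \<Longrightarrow> test_function L \<psi> \<Longrightarrow>
    integral\<^sup>L (ivl L) (\<lambda>s. (deriv ^^ k) \<psi> s *\<^sub>R f s) = (-1) ^ k *\<^sub>R integral\<^sup>L (ivl L) (\<lambda>s. \<psi> s *\<^sub>R g s)"
  by (simp add: has_weak_deriv_def)

lemma has_weak_deriv_unique:
  assumes "has_weak_deriv L k f g" "has_weak_deriv L k f h"
    and int: "integrable (ivl L) g" "integrable (ivl L) h"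
  shows "AE s in ivl L. g s = h s"
proof -
  have "AE s in ivl L. g s - h s = 0"
  proof (rule fundamental_lemma)
    fix \<psi> assume \<psi>: "test_function L \<psi>"
    have "(-1) ^ k *\<^sub>R integral\<^sup>L (ivl L) (\<lambda>s. \<psi> s *\<^sub>R g s) = (-1) ^ k *\<^sub>R integral\<^sup>L (ivl L) (\<lambda>s. \<psi> s *\<^sub>R h s)"
      by (rule trans[OF has_weak_derivD[OF assms(1) \<psi>, symmetric] has_weak_derivD[OF assms(2) \<psi>]])
    then show "integral\<^sup>L (ivl L) (\<lambda>s. \<psi> s *\<^sub>R (g s - h s)) = 0"
      unfolding scaleR_diff_right
      by (subst Bochner_Integration.integral_diff) (auto intro!: integrable_test \<psi> int)
  qed (use int in simp)
  then show ?thesis by simp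
qed

lemma has_weak_deriv_cong_AE:
  assumes "has_weak_deriv L k f g" "integrable (ivl L) f" "integrable (ivl L) f'" "AE s in ivl L. f s = f' s"
    and "integrable (ivl L) g" "integrable (ivl L) g'" "AE s in ivl L. g s = g' s"
  shows "has_weak_deriv L k f' g'"
  unfolding has_weak_deriv_def
proof (intro allI impI)
  fix \<psi> assume \<psi>: "test_function L \<psi>"
  have "integral\<^sup>L (ivl L) (\<lambda>s. (deriv ^^ k) \<psi> s *\<^sub>R f s) = integral\<^sup>L (ivl L) (\<lambda>s. (deriv ^^ k) \<psi> s *\<^sub>R f' s)"
    using assms(4) by (intro integral_cong_AE borel_measurable_integrable integrable_test
        test_function_funpow \<psi> assms(2,3)) auto
  moreover have "integral\<^sup>L (ivl L) (\<lambda>s. \<psi> s *\<^sub>R g s) = integral\<^sup>L (ivl L) (\<lambda>s. \<psi> s *\<^sub>R g' s)"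
    using assms(7) by (intro integral_cong_AE borel_measurable_integrable integrable_test
        \<psi> assms(5,6)) auto
  ultimately show "integral\<^sup>L (ivl L) (\<lambda>s. (deriv ^^ k) \<psi> s *\<^sub>R f' s)
        = (-1) ^ k *\<^sub>R integral\<^sup>L (ivl L) (\<lambda>s. \<psi> s *\<^sub>R g' s)"
    using has_weak_derivD[OF assms(1) \<psi>] by (simp only:)
qed

lemma has_weak_deriv_0: "has_weak_deriv L 0 f f"
  by (simp add: has_weak_deriv_def)

lemma has_weak_deriv_scaleR:
  assumes "has_weak_deriv L k f g"
  shows "has_weak_deriv L k (\<lambda>s. c *\<^sub>R f s) (\<lambda>s. c *\<^sub>R g s)"
  using assms unfolding has_weak_deriv_def
  by (simp add: scaleR_left_commute[of _ c] del: scaleR_scaleR)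

lemma has_weak_deriv_add:
  assumes "has_weak_deriv L k f g" "has_weak_deriv L k f' g'"
    and "integrable (ivl L) f" "integrable (ivl L) f'" "integrable (ivl L) g" "integrable (ivl L) g'"
  shows "has_weak_deriv L k (\<lambda>s. f s + f' s) (\<lambda>s. g s + g' s)"
  using assms unfolding has_weak_deriv_def
  by (auto simp: scaleR_add_right integrable_test[OF test_function_funpow] integrable_test)

text \<open>
  The sign \<open>(-1) ^ k\<close> in the definition is what makes weak derivatives compose.
\<close>

lemma has_weak_deriv_Suc:
  assumes "has_weak_deriv L k f g" "has_weak_deriv L (Suc 0) g h"
  shows "has_weak_deriv L (Suc k) f h"
  unfolding has_weak_deriv_def
proof (intro allI impI)
  fix \<psi> assume \<psi>: "test_function L \<psi>"
  have "integral\<^sup>L (ivl L) (\<lambda>s. (deriv ^^ Suc k) \<psi> s *\<^sub>R f s)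
      = integral\<^sup>L (ivl L) (\<lambda>s. (deriv ^^ k) (deriv \<psi>) s *\<^sub>R f s)"
    by (simp only: funpow_Suc_right o_def)
  also have "\<dots> = (-1) ^ k *\<^sub>R integral\<^sup>L (ivl L) (\<lambda>s. deriv \<psi> s *\<^sub>R g s)"
    using assms(1) test_function_deriv[OF \<psi>] by (simp add: has_weak_deriv_def)
  also have "\<dots> = (-1) ^ k *\<^sub>R (-1) ^ Suc 0 *\<^sub>R integral\<^sup>L (ivl L) (\<lambda>s. \<psi> s *\<^sub>R h s)"
    using assms(2) \<psi> by (simp add: has_weak_deriv_def)
  finally show "integral\<^sup>L (ivl L) (\<lambda>s. (deriv ^^ Suc k) \<psi> s *\<^sub>R f s)
      = (-1) ^ Suc k *\<^sub>R integral\<^sup>L (ivl L) (\<lambda>s. \<psi> s *\<^sub>R h s)" by simp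
qed

text \<open>
  The derivative of a test function is a test function, so testing with \<open>deriv \<psi>\<close> lowers the order of a weak derivative.
  This reduces questions about all orders to weak derivatives of order one.
\<close>

lemma has_weak_deriv_first:
  assumes "has_weak_deriv L k f g" "has_weak_deriv L (Suc k) f h"
  shows "has_weak_deriv L (Suc 0) g h"
  unfolding has_weak_deriv_def
proof (intro allI impI)
  fix \<psi> assume \<psi>: "test_function L \<psi>"
  have "(-1) ^ k *\<^sub>R integral\<^sup>L (ivl L) (\<lambda>s. deriv \<psi> s *\<^sub>R g s)
      = integral\<^sup>L (ivl L) (\<lambda>s. (deriv ^^ k) (deriv \<psi>) s *\<^sub>R f s)"
    using assms(1) test_function_deriv[OF \<psi>] by (simp add: has_weak_deriv_def)
  also have "\<dots> = integral\<^sup>L (ivl L) (\<lambda>s. (deriv ^^ Suc k) \<psi> s *\<^sub>R f s)"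
    by (simp only: funpow_Suc_right o_def)
  also have "\<dots> = (-1) ^ Suc k *\<^sub>R integral\<^sup>L (ivl L) (\<lambda>s. \<psi> s *\<^sub>R h s)"
    using assms(2) \<psi> by (simp only: has_weak_deriv_def)
  also have "\<dots> = (-1) ^ k *\<^sub>R (-1) ^ Suc 0 *\<^sub>R integral\<^sup>L (ivl L) (\<lambda>s. \<psi> s *\<^sub>R h s)" by simp
  finally show "integral\<^sup>L (ivl L) (\<lambda>s. (deriv ^^ Suc 0) \<psi> s *\<^sub>R g s)
      = (-1) ^ Suc 0 *\<^sub>R integral\<^sup>L (ivl L) (\<lambda>s. \<psi> s *\<^sub>R h s)"
    unfolding scaleR_cancel_left by (simp add: minus_one_power_iff split: if_splits)
qed

lemma has_weak_deriv_prim: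
  fixes G :: "real \<Rightarrow> 'a::euclidean_space"
  assumes g: "integrable (ivl L) g" and L: "0 < L"
    and G: "\<And>s. s \<in> {0..L} \<Longrightarrow> G s = G 0 + prim L g s"
  shows "has_weak_deriv L (Suc 0) G g"
  unfolding has_weak_deriv_def
proof (intro allI impI)
  fix \<psi> assume \<psi>: "test_function L \<psi>"
  have "integral\<^sup>L (ivl L) (\<lambda>s. deriv \<psi> s *\<^sub>R G s) + integral\<^sup>L (ivl L) (\<lambda>s. \<psi> s *\<^sub>R g s)
      = \<psi> L *\<^sub>R G L - \<psi> 0 *\<^sub>R G 0"
    by (intro integration_by_parts_prim test_function_has_vector_derivative[OF \<psi>]
        test_function_continuous_on[OF test_function_deriv[OF \<psi>]] g L G)
  then show "integral\<^sup>L (ivl L) (\<lambda>s. (deriv ^^ Suc 0) \<psi> s *\<^sub>R G s)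
      = (-1) ^ Suc 0 *\<^sub>R integral\<^sup>L (ivl L) (\<lambda>s. \<psi> s *\<^sub>R g s)"
    by (simp add: test_function_eq_0[OF \<psi>] add_eq_0_iff2)
qed

text \<open>
  The primitive of a test function vanishes to the left of the support, and to the right of it because
  the total integral is zero.
\<close>

lemma test_function_antiderivative:
  assumes \<psi>: "test_function L \<psi>" and 0: "integral\<^sup>L (ivl L) \<psi> = 0" and L: "0 < L"
  obtains u where "test_function L u" "deriv u = \<psi>"
proof -
  let ?K = "closure {s. \<psi> s \<noteq> 0}"
  have K: "?K \<subseteq> {0<..<L}" using \<psi> by (simp add: test_function_iff)
  have "compact ?K"
    unfolding compact_closure
    by (rule bounded_subset[of "{0<..<L}"]) (use K closure_subset[of "{s. \<psi> s \<noteq> 0}"] in \<open>auto intro: bounded_box[of 0 L, unfolded box_real]\<close>)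
  obtain a b where ab: "0 < a" "b < L" "?K \<subseteq> {a..b}"
  proof (cases "?K = {}")
    case True
    with L show ?thesis by (intro that[of L 0]) auto
  next
    case False
    obtain a where a: "a \<in> ?K" "\<forall>x\<in>?K. a \<le> x"
      using compact_attains_inf[OF \<open>compact ?K\<close> False] by blast
    obtain b where b: "b \<in> ?K" "\<forall>x\<in>?K. x \<le> b"
      using compact_attains_sup[OF \<open>compact ?K\<close> False] by blast
    show ?thesis
      by (rule that[of a b]) (use K a b in \<open>auto simp del: closure_eq_empty\<close>)
  qed
  have zero: "\<psi> r = 0" if "r \<notin> {a..b}" for r
    using that ab(3) closure_subset[of "{s. \<psi> s \<noteq> 0}"] by blast
  have left: "prim L \<psi> x = 0" if "x < a" for x
  proof -
    have "prim L \<psi> x = integral\<^sup>L (ivl L) (\<lambda>r. 0)"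
      unfolding prim_def using that zero
      by (intro Bochner_Integration.integral_cong) (auto simp: indicator_def)
    then show ?thesis by simp
  qed
  have right: "prim L \<psi> x = 0" if "x > b" for x
  proof -
    have "prim L \<psi> x = integral\<^sup>L (ivl L) \<psi>"
      unfolding prim_def using that zero
      by (intro Bochner_Integration.integral_cong) (auto simp: indicator_def)
    with 0 show ?thesis by simp
  qed
  have D: "(prim L \<psi> has_real_derivative \<psi> x) (at x)" for x
  proof -
    consider "x < a" | "x > b" | "x \<in> {0<..<L}" using ab by fastforce
    then show ?thesis
    proof cases
      case 1
      have "((\<lambda>_. 0) has_real_derivative \<psi> x) (at x)" using zero[of x] 1 by simp
      then show ?thesis
        by (rule has_field_derivative_transform_within_open[where S="{..<a}"]) (use 1 left in auto)
    next
      case 2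
      have "((\<lambda>_. 0) has_real_derivative \<psi> x) (at x)" using zero[of x] 2 by simp
      then show ?thesis
        by (rule has_field_derivative_transform_within_open[where S="{b<..}"]) (use 2 right in auto)
    next
      case 3
      then have "(prim L \<psi> has_vector_derivative \<psi> x) (at x within {0..L})"
        by (intro prim_has_vector_derivative test_function_continuous_on[OF \<psi>]) auto
      moreover have "at x within {0..L} = at x" using 3 by (intro at_within_interior) auto
      ultimately show ?thesis by (simp add: has_real_derivative_iff_has_vector_derivative)
    qed
  qed
  have "closure {s. prim L \<psi> s \<noteq> 0} \<subseteq> {a..b}"
    using left right by (intro closure_minimal) (auto simp: not_less[symmetric])
  with ab have "closure {s. prim L \<psi> s \<noteq> 0} \<subseteq> {0<..<L}" by force
  moreover have "smooth (prim L \<psi>)"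
    using \<psi> by (intro smoothI_deriv[OF D]) (simp add: test_function_iff)
  ultimately have "test_function L (prim L \<psi>)" by (simp add: test_function_iff)
  moreover have "deriv (prim L \<psi>) = \<psi>" using D by (auto intro!: DERIV_imp_deriv)
  ultimately show ?thesis by (rule that)
qed

text \<open>
  The lemma of du Bois-Reymond. The hypothesis can be tested only with derivatives of test functions, that is, with test functions of
  integral zero; every test function becomes one of these after subtraction of a multiple of a fixed bump, and
  the constant \<open>c\<close> accounts for the multiple.
\<close>

lemma weak_deriv_0_imp_const:
  fixes f :: "real \<Rightarrow> 'a::euclidean_space"
  assumes f: "integrable (ivl L) f" and wd: "has_weak_deriv L (Suc 0) f (\<lambda>_. 0)" and L: "0 < L"
  obtains c where "AE s in ivl L. f s = c"
proof -
  \<comment> \<open>Any test function with nonzero integral would do.\<close>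
  let ?\<eta> = "bump (L/3) (2*L/3) 0"
  have \<eta>: "test_function L ?\<eta>" using L by (intro test_function_bump) auto
  have int_\<eta>: "integrable (ivl L) ?\<eta>"
    by (intro integrable_ivl_continuous test_function_continuous_on[OF \<eta>])
  let ?I = "integral\<^sup>L (ivl L) ?\<eta>"
  have "?I \<noteq> 0"
  proof
    assume "?I = 0"
    then have "AE s in ivl L. ?\<eta> s = 0"
      using int_\<eta> by (subst (asm) integral_nonneg_eq_0_iff_AE) (auto simp: bump_bounds)
    then have "?\<eta> (L/2) = 0"
      using L by (intro continuous_on_AE_unique[of L ?\<eta> "\<lambda>_. 0"] test_function_continuous_on[OF \<eta>]) auto
    then show False using L by (simp add: bump_eq_0_iff)
  qed
  define c where "c = (1 / ?I) *\<^sub>R integral\<^sup>L (ivl L) (\<lambda>s. ?\<eta> s *\<^sub>R f s)"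
  have "AE s in ivl L. f s - c = 0"
  proof (rule fundamental_lemma)
    show "integrable (ivl L) (\<lambda>s. f s - c)"
      using f by (intro Bochner_Integration.integrable_diff finite_measure.integrable_const finite_measure_ivl)
    fix \<psi> assume \<psi>: "test_function L \<psi>"
    have int_\<psi>: "integrable (ivl L) \<psi>"
      by (intro integrable_ivl_continuous test_function_continuous_on[OF \<psi>])
    \<comment> \<open>The multiple of the bump that makes the integral of \<open>?\<xi>\<close> zero.\<close>
    let ?k = "integral\<^sup>L (ivl L) \<psi> / ?I"
    let ?\<xi> = "\<lambda>s. \<psi> s + (- ?k) * ?\<eta> s"
    have "smooth ?\<xi>"
      using \<psi> \<eta> by (intro smooth_add smooth_mult smooth_const) (auto simp: test_function_iff)
    moreover have "closure {s. ?\<xi> s \<noteq> 0} \<subseteq> closure ({s. \<psi> s \<noteq> 0} \<union> {s. ?\<eta> s \<noteq> 0})"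
      by (intro closure_mono) auto
    ultimately have \<xi>: "test_function L ?\<xi>"
      using \<psi> \<eta> unfolding test_function_iff closure_Un by blast
    have "integral\<^sup>L (ivl L) ?\<xi> = 0"
      using \<open>?I \<noteq> 0\<close> int_\<psi> int_\<eta> by (subst Bochner_Integration.integral_add) auto
    from test_function_antiderivative[OF \<xi> this L]
    obtain u where u: "test_function L u" "deriv u = ?\<xi>" .
    have "0 = integral\<^sup>L (ivl L) (\<lambda>s. deriv u s *\<^sub>R f s)"
      using wd u(1) by (simp add: has_weak_deriv_def)
    also have "\<dots> = integral\<^sup>L (ivl L) (\<lambda>s. \<psi> s *\<^sub>R f s - ?k *\<^sub>R (?\<eta> s *\<^sub>R f s))"
      unfolding u(2) by (simp add: scaleR_left_diff_distrib)
    also have "\<dots> = integral\<^sup>L (ivl L) (\<lambda>s. \<psi> s *\<^sub>R f s) - integral\<^sup>L (ivl L) \<psi> *\<^sub>R c"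
      unfolding c_def
      by (subst Bochner_Integration.integral_diff[OF integrable_test[OF \<psi> f]
            integrable_scaleR_right[OF integrable_test[OF \<eta> f]]])
        (simp only: integral_scaleR_right, simp)
    also have "\<dots> = integral\<^sup>L (ivl L) (\<lambda>s. \<psi> s *\<^sub>R (f s - c))"
      unfolding scaleR_diff_right
      using \<psi> f int_\<psi> by (subst Bochner_Integration.integral_diff) (auto intro!: integrable_test)
    finally show "integral\<^sup>L (ivl L) (\<lambda>s. \<psi> s *\<^sub>R (f s - c)) = 0" by simp
  qed
  then have "AE s in ivl L. f s = c" by simp
  then show ?thesis by (rule that)
qed


text \<open>
  In one dimension a function with an integrable weak derivative is, up to a null set, an absolutely
  continuous function: it differs from the primitive of its weak derivative by a function with weak derivative zero.
\<close>

lemma has_weak_deriv_imp_prim: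
  fixes f :: "real \<Rightarrow> 'a::euclidean_space"
  assumes f: "integrable (ivl L) f" and g: "integrable (ivl L) g"
    and wd: "has_weak_deriv L (Suc 0) f g" and L: "0 < L"
  obtains c where "AE s in ivl L. f s = c + prim L g s"
proof -
  let ?h = "\<lambda>s. f s + (-1) *\<^sub>R prim L g s"
  have p: "integrable (ivl L) (prim L g)"
    by (intro integrable_ivl_continuous continuous_prim g)
  have "has_weak_deriv L (Suc 0) ?h (\<lambda>s. g s + (-1) *\<^sub>R g s)"
    by (intro has_weak_deriv_add has_weak_deriv_scaleR wd has_weak_deriv_prim f g L
        integrable_scaleR_right p) auto
  then have "has_weak_deriv L (Suc 0) ?h (\<lambda>_. 0)" by simp
  moreover have "integrable (ivl L) ?h"
    by (intro Bochner_Integration.integrable_add integrable_scaleR_right f p)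
  ultimately obtain c where "AE s in ivl L. ?h s = c"
    using weak_deriv_0_imp_const L by blast
  then have "AE s in ivl L. f s = c + prim L g s"
    by eventually_elim (simp add: algebra_simps)
  then show ?thesis by (rule that)
qed

section \<open>Sobolev functions and their traces\<close>

lemma sobolev_imp_L2: "f \<in> sobolev L m \<Longrightarrow> f \<in> L2_space L"
  by (simp add: sobolev_def)

lemma weak_deriv:
  assumes "f \<in> sobolev L m" "k \<le> m"
  shows "weak_deriv L k f \<in> L2_space L" "has_weak_deriv L k f (weak_deriv L k f)"
proof -
  have "\<exists>g. g \<in> L2_space L \<and> has_weak_deriv L k f g"
    using assms unfolding sobolev_def by blast
  from someI_ex[OF this]
  show "weak_deriv L k f \<in> L2_space L" "has_weak_deriv L k f (weak_deriv L k f)"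
    unfolding weak_deriv_def by auto
qed

lemma weak_deriv_AE_eq:
  assumes "has_weak_deriv L k f g" "g \<in> L2_space L"
  shows "weak_deriv L k f \<in> L2_space L" "AE s in ivl L. weak_deriv L k f s = g s"
proof -
  have "\<exists>g. g \<in> L2_space L \<and> has_weak_deriv L k f g" using assms by blast
  from someI_ex[OF this]
  have *: "weak_deriv L k f \<in> L2_space L" "has_weak_deriv L k f (weak_deriv L k f)"
    unfolding weak_deriv_def by auto
  show "weak_deriv L k f \<in> L2_space L" by fact
  show "AE s in ivl L. weak_deriv L k f s = g s"
    by (rule has_weak_deriv_unique[OF *(2) assms(1)]) (intro L2_space_integrable * assms)+
qed

text \<open>
  An equality of functions, not only almost everywhere: both sides choose from the same set of candidates.
\<close>

lemma weak_deriv_cong_AE: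
  assumes f: "f \<in> L2_space L" "g \<in> L2_space L" and ae: "AE s in ivl L. f s = g s"
  shows "weak_deriv L k f = weak_deriv L k g"
proof -
  have "has_weak_deriv L k f h \<longleftrightarrow> has_weak_deriv L k g h" if h: "h \<in> L2_space L" for h
  proof
    have ae': "AE s in ivl L. g s = f s" using ae by eventually_elim simp
    show "has_weak_deriv L k g h" if "has_weak_deriv L k f h"
      by (rule has_weak_deriv_cong_AE[OF that]) (intro L2_space_integrable f h ae AE_I2 refl)+
    show "has_weak_deriv L k f h" if "has_weak_deriv L k g h"
      by (rule has_weak_deriv_cong_AE[OF that]) (intro L2_space_integrable f h ae' AE_I2 refl)+
  qed
  then show ?thesis unfolding weak_deriv_def by metis
qed

lemma sobolev_norm_cong_AE:
  assumes "f \<in> L2_space L" "g \<in> L2_space L" "AE s in ivl L. f s = g s"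
  shows "sobolev_norm L m f = sobolev_norm L m g"
  using weak_deriv_cong_AE[OF assms] by (simp add: sobolev_norm_def)

lemma sobolev_lincomb:
  assumes f: "f \<in> sobolev L m" and g: "g \<in> sobolev L m"
  shows "(\<lambda>s. a *\<^sub>R f s + b *\<^sub>R g s) \<in> sobolev L m"
    and "k \<le> m \<Longrightarrow> AE s in ivl L. weak_deriv L k (\<lambda>s. a *\<^sub>R f s + b *\<^sub>R g s) s
           = a *\<^sub>R weak_deriv L k f s + b *\<^sub>R weak_deriv L k g s"
proof -
  let ?g = "\<lambda>k s. a *\<^sub>R weak_deriv L k f s + b *\<^sub>R weak_deriv L k g s"
  have L2: "(\<lambda>s. a *\<^sub>R f s + b *\<^sub>R g s) \<in> L2_space L"
    by (intro L2_space_add L2_space_scaleR sobolev_imp_L2[OF f] sobolev_imp_L2[OF g])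
  have *: "?g k \<in> L2_space L" "has_weak_deriv L k (\<lambda>s. a *\<^sub>R f s + b *\<^sub>R g s) (?g k)" if "k \<le> m" for k
    using weak_deriv[OF f that] weak_deriv[OF g that] sobolev_imp_L2[OF f] sobolev_imp_L2[OF g]
    by (auto intro!: L2_space_add L2_space_scaleR has_weak_deriv_add has_weak_deriv_scaleR
        L2_space_integrable)
  then show "(\<lambda>s. a *\<^sub>R f s + b *\<^sub>R g s) \<in> sobolev L m"
    unfolding sobolev_def using L2 by blast
  show "AE s in ivl L. weak_deriv L k (\<lambda>s. a *\<^sub>R f s + b *\<^sub>R g s) s = ?g k s" if "k \<le> m"
    using * that by (intro weak_deriv_AE_eq)
qed

lemma cont_rep:
  fixes F :: "real \<Rightarrow> 'a::euclidean_space"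
  assumes F: "continuous_on {0..L} F" and ae: "AE s in ivl L. F s = f s" and L: "0 < L"
  shows "continuous_on {0..L} (cont_rep L f)" "AE s in ivl L. cont_rep L f s = f s"
    "s \<in> {0..L} \<Longrightarrow> cont_rep L f s = F s"
proof -
  have "\<exists>g. continuous_on {0..L} g \<and> (AE s in ivl L. g s = f s)" using F ae by blast
  from someI_ex[OF this]
  show *: "continuous_on {0..L} (cont_rep L f)" "AE s in ivl L. cont_rep L f s = f s"
    unfolding cont_rep_def by auto
  have "AE s in ivl L. cont_rep L f s = F s" using *(2) ae by eventually_elim simp
  then show "s \<in> {0..L} \<Longrightarrow> cont_rep L f s = F s"
    by (intro continuous_on_AE_unique[OF *(1) F _ _ L])
qed

lemma sob_deriv_eqI:
  fixes F :: "real \<Rightarrow> 'a::euclidean_space"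
  assumes F: "continuous_on {0..L} F" "has_weak_deriv L k f F" and L: "0 < L" and s: "s \<in> {0..L}"
  shows "sob_deriv L k f s = F s"
proof -
  have "AE s in ivl L. weak_deriv L k f s = F s"
    using F by (intro weak_deriv_AE_eq L2_space_continuous)
  then have "AE s in ivl L. F s = weak_deriv L k f s" by eventually_elim simp
  then show ?thesis unfolding sob_deriv_def by (rule cont_rep(3)[OF F(1) _ L s])
qed

text \<open>
  Below the top order, the chosen representatives behave like classical derivatives up to the boundary:
  the last part is the fundamental theorem of calculus.
\<close>

lemma sob_deriv:
  fixes f :: "real \<Rightarrow> 'a::euclidean_space"
  assumes f: "f \<in> sobolev L m" and k: "k < m" and L: "0 < L"
  shows "continuous_on {0..L} (sob_deriv L k f)"
    and "AE s in ivl L. sob_deriv L k f s = weak_deriv L k f s"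
    and "has_weak_deriv L k f (sob_deriv L k f)"
    and "s \<in> {0..L} \<Longrightarrow> sob_deriv L k f s = sob_deriv L k f 0 + prim L (weak_deriv L (Suc k) f) s"
proof -
  let ?G = "weak_deriv L k f" and ?H = "weak_deriv L (Suc k) f"
  have G: "?G \<in> L2_space L" "has_weak_deriv L k f ?G" using weak_deriv[OF f, of k] k by auto
  have H: "?H \<in> L2_space L" "has_weak_deriv L (Suc k) f ?H" using weak_deriv[OF f, of "Suc k"] k by auto
  from has_weak_deriv_imp_prim[OF L2_space_integrable[OF G(1)] L2_space_integrable[OF H(1)]
      has_weak_deriv_first[OF G(2) H(2)] L]
  obtain c where c: "AE s in ivl L. ?G s = c + prim L ?H s" .
  then have ae: "AE s in ivl L. c + prim L ?H s = ?G s" by eventually_elim simp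
  have cont: "continuous_on {0..L} (\<lambda>s. c + prim L ?H s)"
    by (intro continuous_intros continuous_prim L2_space_integrable H)
  note * = cont_rep[OF cont ae L, folded sob_deriv_def]
  show 1: "continuous_on {0..L} (sob_deriv L k f)"
    and 2: "AE s in ivl L. sob_deriv L k f s = ?G s" by (fact *)+
  have ae2: "AE s in ivl L. ?G s = sob_deriv L k f s" using 2 by eventually_elim simp
  show "has_weak_deriv L k f (sob_deriv L k f)"
    by (rule has_weak_deriv_cong_AE[OF G(2) _ _ _ _ _ ae2])
      (intro L2_space_integrable sobolev_imp_L2[OF f] G AE_I2 refl integrable_ivl_continuous 1)+
  have "sob_deriv L k f 0 = c" using *(3)[of 0] L by simp
  with *(3) show "s \<in> {0..L} \<Longrightarrow> sob_deriv L k f s = sob_deriv L k f 0 + prim L ?H s" by simp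
qed

lemma sob_deriv_has_vector_derivative:
  fixes f :: "real \<Rightarrow> 'a::euclidean_space"
  assumes f: "f \<in> sobolev L m" and k: "Suc k < m" and L: "0 < L" and s: "s \<in> {0..L}"
  shows "(sob_deriv L k f has_vector_derivative sob_deriv L (Suc k) f s) (at s within {0..L})"
proof -
  have "prim L (weak_deriv L (Suc k) f) s = prim L (sob_deriv L (Suc k) f) s" for s
    using k weak_deriv[OF f, of "Suc k"] sob_deriv(1,2)[OF f k L]
    by (intro prim_cong_AE L2_space_integrable integrable_ivl_continuous) (auto elim: AE_mp)
  then have eq: "sob_deriv L k f s = sob_deriv L k f 0 + prim L (sob_deriv L (Suc k) f) s" if "s \<in> {0..L}" for s
    using sob_deriv(4)[OF f _ L that, of k] k by simp
  have "((\<lambda>s. sob_deriv L k f 0 + prim L (sob_deriv L (Suc k) f) s) has_vector_derivative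
      0 + sob_deriv L (Suc k) f s) (at s within {0..L})"
    by (intro derivative_intros prim_has_vector_derivative sob_deriv(1)[OF f k L] s)
  then show ?thesis
    using has_vector_derivative_transform[OF s eq] by simp
qed

lemma sob_deriv_lincomb:
  fixes f g :: "real \<Rightarrow> 'a::euclidean_space"
  assumes f: "f \<in> sobolev L m" and g: "g \<in> sobolev L m" and k: "k < m" and L: "0 < L" and s: "s \<in> {0..L}"
  shows "sob_deriv L k (\<lambda>s. a *\<^sub>R f s + b *\<^sub>R g s) s = a *\<^sub>R sob_deriv L k f s + b *\<^sub>R sob_deriv L k g s"
proof (rule sob_deriv_eqI[OF _ _ L s])
  note F = sob_deriv(1,3)[OF f k L] and G = sob_deriv(1,3)[OF g k L]
  show "continuous_on {0..L} (\<lambda>s. a *\<^sub>R sob_deriv L k f s + b *\<^sub>R sob_deriv L k g s)"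
    by (intro continuous_intros F G)
  show "has_weak_deriv L k (\<lambda>s. a *\<^sub>R f s + b *\<^sub>R g s) (\<lambda>s. a *\<^sub>R sob_deriv L k f s + b *\<^sub>R sob_deriv L k g s)"
    by (intro has_weak_deriv_add has_weak_deriv_scaleR F G integrable_scaleR_right
        L2_space_integrable[OF sobolev_imp_L2[OF f]] L2_space_integrable[OF sobolev_imp_L2[OF g]]
        integrable_ivl_continuous)
qed

lemma sobolev_diff:
  assumes "f \<in> sobolev L m" "g \<in> sobolev L m"
  shows "(\<lambda>s. f s - g s) \<in> sobolev L m"
    and "k \<le> m \<Longrightarrow> AE s in ivl L. weak_deriv L k (\<lambda>s. f s - g s) s = weak_deriv L k f s - weak_deriv L k g s"
  using sobolev_lincomb[OF assms, where a=1 and b="-1"] by simp_all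

lemma sob_deriv_diff:
  fixes f g :: "real \<Rightarrow> 'a::euclidean_space"
  assumes "f \<in> sobolev L m" "g \<in> sobolev L m" "k < m" "0 < L" "s \<in> {0..L}"
  shows "sob_deriv L k (\<lambda>s. f s - g s) s = sob_deriv L k f s - sob_deriv L k g s"
  using sob_deriv_lincomb[OF assms, where a=1 and b="-1"] by simp

section \<open>Smooth functions as Sobolev functions\<close>

text \<open>
  A smooth function given together with all of its derivatives. For such functions the chosen weak
  derivatives and their continuous representatives are the given ones.
\<close>

definition deriv_chain :: "real \<Rightarrow> (nat \<Rightarrow> real \<Rightarrow> 'a::euclidean_space) \<Rightarrow> bool" where
  "deriv_chain L F \<longleftrightarrow>
    (\<forall>k. \<forall>s\<in>{0..L}. (F k has_vector_derivative F (Suc k) s) (at s within {0..L}))"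

lemma deriv_chain_continuous: "deriv_chain L F \<Longrightarrow> continuous_on {0..L} (F k)"
  unfolding deriv_chain_def by (intro continuous_on_vector_derivative[of _ _ "F (Suc k)"]) blast

lemma deriv_chain_shift: "deriv_chain L F \<Longrightarrow> deriv_chain L (\<lambda>k. F (j + k))"
  unfolding deriv_chain_def by simp

lemma deriv_chain_diff: "deriv_chain L F \<Longrightarrow> deriv_chain L G \<Longrightarrow> deriv_chain L (\<lambda>k s. F k s - G k s)"
  unfolding deriv_chain_def by (auto intro: has_vector_derivative_diff)

lemma deriv_chain_weak:
  assumes F: "deriv_chain L F" and L: "0 < L"
  shows "has_weak_deriv L k (F 0) (F k)"
proof (induction k)
  case (Suc k)
  have "F k s = F k 0 + prim L (F (Suc k)) s" if "s \<in> {0..L}" for s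
    using F that by (subst prim_of_derivative[of L "F k"])
      (auto simp: deriv_chain_def intro!: deriv_chain_continuous)
  then have "has_weak_deriv L (Suc 0) (F k) (F (Suc k))"
    by (intro has_weak_deriv_prim integrable_ivl_continuous deriv_chain_continuous F L)
  with Suc show ?case by (rule has_weak_deriv_Suc)
qed (rule has_weak_deriv_0)

lemma deriv_chain_sobolev:
  assumes F: "deriv_chain L F" and L: "0 < L"
  shows "F 0 \<in> sobolev L m" "AE s in ivl L. weak_deriv L k (F 0) s = F k s"
    "weak_deriv L k (F 0) \<in> L2_space L" "s \<in> {0..L} \<Longrightarrow> sob_deriv L k (F 0) s = F k s"
proof -
  have L2: "F k \<in> L2_space L" for k
    by (intro L2_space_continuous deriv_chain_continuous F)
  show "F 0 \<in> sobolev L m"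
    unfolding sobolev_def using L2 deriv_chain_weak[OF F L] by blast
  show "AE s in ivl L. weak_deriv L k (F 0) s = F k s" "weak_deriv L k (F 0) \<in> L2_space L"
    using weak_deriv_AE_eq[OF deriv_chain_weak[OF F L] L2] by auto
  show "s \<in> {0..L} \<Longrightarrow> sob_deriv L k (F 0) s = F k s"
    by (intro sob_deriv_eqI deriv_chain_weak deriv_chain_continuous F L)
qed

section \<open>Norms\<close>

text \<open>
  The square of the \<open>L\<^sup>2\<close> norm, which spares square roots in energy identities.
\<close>

definition sqnorm :: "real \<Rightarrow> (real \<Rightarrow> 'a::euclidean_space) \<Rightarrow> real" where
  "sqnorm L f = integral\<^sup>L (ivl L) (\<lambda>s. (norm (f s))\<^sup>2)"

lemma sqnorm_nonneg: "0 \<le> sqnorm L f"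
  unfolding sqnorm_def by simp

lemma L2_integrable_sqnorm: "f \<in> L2_space L \<Longrightarrow> integrable (ivl L) (\<lambda>s. (norm (f s))\<^sup>2)"
  by (simp add: L2_space_def)

lemma sqnorm_cong_AE:
  assumes "f \<in> L2_space L" "g \<in> L2_space L" "AE s in ivl L. f s = g s"
  shows "sqnorm L f = sqnorm L g"
  unfolding sqnorm_def using assms
  by (intro integral_cong_AE borel_measurable_integrable L2_integrable_sqnorm) auto

lemma sqnorm_weak_deriv_le:
  assumes "k \<le> m" shows "sqnorm L (weak_deriv L k f) \<le> (sobolev_norm L m f)\<^sup>2"
proof -
  have "(sobolev_norm L m f)\<^sup>2 = (\<Sum>k\<le>m. sqnorm L (weak_deriv L k f))"
    unfolding sobolev_norm_def sqnorm_def by (simp add: sum_nonneg)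
  also have "\<dots> \<ge> sqnorm L (weak_deriv L k f)"
    using assms by (intro member_le_sum) (auto simp: sqnorm_nonneg)
  finally show ?thesis .
qed

lemma deriv_chain_sobolev_norm:
  assumes "deriv_chain L F" "0 < L"
  shows "sobolev_norm L m (F 0) = sqrt (\<Sum>k\<le>m. sqnorm L (F k))"
proof -
  have "sqnorm L (weak_deriv L k (F 0)) = sqnorm L (F k)" for k
    by (intro sqnorm_cong_AE deriv_chain_sobolev assms L2_space_continuous deriv_chain_continuous)
  then show ?thesis unfolding sobolev_norm_def sqnorm_def by simp
qed

lemma L2_integrable_inner:
  fixes f g :: "real \<Rightarrow> 'a::euclidean_space"
  assumes f: "f \<in> L2_space L" and g: "g \<in> L2_space L"
  shows "integrable (ivl L) (\<lambda>s. f s \<bullet> g s)"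
proof (rule Bochner_Integration.integrable_bound)
  show "integrable (ivl L) (\<lambda>s. (norm (f s))\<^sup>2 + (norm (g s))\<^sup>2)"
    by (intro Bochner_Integration.integrable_add L2_integrable_sqnorm f g)
  show "(\<lambda>s. f s \<bullet> g s) \<in> borel_measurable (ivl L)"
    using f g unfolding L2_space_def by (intro borel_measurable_inner) auto
  have "\<bar>f s \<bullet> g s\<bar> \<le> (norm (f s))\<^sup>2 + (norm (g s))\<^sup>2" for s
  proof -
    have "\<bar>f s \<bullet> g s\<bar> \<le> norm (f s) * norm (g s)" by (rule Cauchy_Schwarz_ineq2)
    then show ?thesis
      using sum_squares_bound[of "norm (f s)" "norm (g s)"] mult_nonneg_nonneg[OF norm_ge_zero norm_ge_zero, of "f s" "g s"]
      by linarith
  qed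
  then show "AE s in ivl L. norm (f s \<bullet> g s) \<le> norm ((norm (f s))\<^sup>2 + (norm (g s))\<^sup>2)"
    by auto
qed

lemma sqnorm_lincomb:
  fixes f g :: "real \<Rightarrow> 'a::euclidean_space"
  assumes f: "f \<in> L2_space L" and g: "g \<in> L2_space L"
  shows "sqnorm L (\<lambda>s. x *\<^sub>R f s + g s)
    = x\<^sup>2 * sqnorm L f + 2 * x * integral\<^sup>L (ivl L) (\<lambda>s. f s \<bullet> g s) + sqnorm L g"
proof -
  have "(norm (x *\<^sub>R f s + g s))\<^sup>2 = x\<^sup>2 * (norm (f s))\<^sup>2 + 2 * x * (f s \<bullet> g s) + (norm (g s))\<^sup>2" for s
    unfolding power2_norm_eq_inner by (simp add: inner_simps inner_commute power2_eq_square algebra_simps)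
  then show ?thesis
    unfolding sqnorm_def using L2_integrable_inner[OF f g] L2_integrable_sqnorm[OF f] L2_integrable_sqnorm[OF g]
    by simp
qed

lemma L2_Cauchy_Schwarz:
  fixes f g :: "real \<Rightarrow> 'a::euclidean_space"
  assumes f: "f \<in> L2_space L" and g: "g \<in> L2_space L"
  shows "(integral\<^sup>L (ivl L) (\<lambda>s. f s \<bullet> g s))\<^sup>2 \<le> sqnorm L f * sqnorm L g"
proof -
  let ?A = "sqnorm L f" and ?B = "integral\<^sup>L (ivl L) (\<lambda>s. f s \<bullet> g s)" and ?C = "sqnorm L g"
  have pos: "0 \<le> x\<^sup>2 * ?A + 2 * x * ?B + ?C" for x
    using sqnorm_lincomb[OF f g, of x] sqnorm_nonneg[of L "\<lambda>s. x *\<^sub>R f s + g s"] by simp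
  show ?thesis
  proof (cases "?A = 0")
    case True
    have "?B = 0"
    proof (rule ccontr)
      assume B: "?B \<noteq> 0"
      \<comment> \<open>The polynomial is affine in this case, and its value here is \<open>-1\<close>.\<close>
      from pos[of "- (?C + 1) / (2 * ?B)"] True B show False by (simp add: field_simps)
    qed
    with True show ?thesis by simp
  next
    case False
    then have A: "?A > 0" using sqnorm_nonneg[of L f] by linarith
    \<comment> \<open>The minimum of the quadratic polynomial.\<close>
    from pos[of "- ?B / ?A"] have "0 \<le> ?C - ?B\<^sup>2 / ?A"
      using A by (simp add: power2_eq_square field_simps)
    then show ?thesis using A by (simp add: field_simps)
  qed
qed

lemma sqnorm_add_le:
  fixes f g :: "real \<Rightarrow> 'a::euclidean_space"
  assumes f: "f \<in> L2_space L" and g: "g \<in> L2_space L"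
  shows "sqnorm L (\<lambda>s. f s + g s) \<le> 2 * sqnorm L f + 2 * sqnorm L g"
  using sqnorm_lincomb[OF f g, of 1] sqnorm_lincomb[OF f g, of "-1"] sqnorm_nonneg[of L "\<lambda>s. (-1) *\<^sub>R f s + g s"]
  by simp

lemma sqnorm_minus: "sqnorm L (\<lambda>s. - f s) = sqnorm L f"
  by (simp add: sqnorm_def)

lemma integral_norm_square_le:
  fixes f :: "real \<Rightarrow> 'a::euclidean_space"
  assumes f: "f \<in> L2_space L" and L: "0 < L"
  shows "(integral\<^sup>L (ivl L) (\<lambda>s. norm (f s)))\<^sup>2 \<le> L * sqnorm L f"
proof -
  have 1: "(\<lambda>s. 1::real) \<in> L2_space L" by (intro L2_space_continuous continuous_intros)
  have 2: "(\<lambda>s. norm (f s)) \<in> L2_space L" using f by (auto simp: L2_space_def)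
  have "sqnorm L (\<lambda>s. 1::real) = L" using measure_ivl[OF L] by (simp add: sqnorm_def)
  with L2_Cauchy_Schwarz[OF 1 2] show ?thesis by (simp add: sqnorm_def)
qed

text \<open>
  A substitute for the triangle inequality that suffices for limits: the constant \<open>2\<close> is harmless.
\<close>

lemma sobolev_norm_diff_le:
  fixes f g :: "real \<Rightarrow> 'a::euclidean_space"
  assumes f: "f \<in> sobolev L m" and g: "g \<in> sobolev L m"
  shows "(sobolev_norm L m (\<lambda>s. f s - g s))\<^sup>2 \<le> 2 * (sobolev_norm L m f)\<^sup>2 + 2 * (sobolev_norm L m g)\<^sup>2"
proof -
  have sq: "(sobolev_norm L m h)\<^sup>2 = (\<Sum>k\<le>m. sqnorm L (weak_deriv L k h))" for h :: "real \<Rightarrow> 'a"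
    unfolding sobolev_norm_def sqnorm_def by (simp add: sum_nonneg)
  have "sqnorm L (weak_deriv L k (\<lambda>s. f s - g s)) \<le> 2 * sqnorm L (weak_deriv L k f) + 2 * sqnorm L (weak_deriv L k g)"
    if "k \<le> m" for k
  proof -
    note F = weak_deriv(1)[OF f that] and G = weak_deriv(1)[OF g that]
    have "sqnorm L (weak_deriv L k (\<lambda>s. f s - g s)) = sqnorm L (\<lambda>s. weak_deriv L k f s - weak_deriv L k g s)"
      by (rule sqnorm_cong_AE[OF weak_deriv(1)[OF sobolev_diff(1)[OF f g] that] L2_space_diff[OF F G]
            sobolev_diff(2)[OF f g that]])
    also have "\<dots> = sqnorm L (\<lambda>s. weak_deriv L k f s + (-1) *\<^sub>R weak_deriv L k g s)" by simp
    also have "\<dots> \<le> 2 * sqnorm L (weak_deriv L k f) + 2 * sqnorm L (\<lambda>s. (-1) *\<^sub>R weak_deriv L k g s)"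
      by (intro sqnorm_add_le F L2_space_scaleR G)
    also have "sqnorm L (\<lambda>s. (-1) *\<^sub>R weak_deriv L k g s) = sqnorm L (weak_deriv L k g)"
      by (simp add: sqnorm_minus)
    finally show ?thesis .
  qed
  then have "(\<Sum>k\<le>m. sqnorm L (weak_deriv L k (\<lambda>s. f s - g s)))
      \<le> (\<Sum>k\<le>m. 2 * sqnorm L (weak_deriv L k f) + 2 * sqnorm L (weak_deriv L k g))"
    by (intro sum_mono) auto
  then show ?thesis unfolding sq by (simp add: sum.distrib sum_distrib_left)
qed

section \<open>Derivatives with respect to time\<close>

lemma sobolev_has_time_deriv_diff:
  fixes u u' :: "real \<Rightarrow> real \<Rightarrow> 'a::euclidean_space"
  assumes u: "sobolev_has_time_deriv L m u v" and u': "sobolev_has_time_deriv L m u' v'"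
  shows "sobolev_has_time_deriv L m (\<lambda>t s. u t s - u' t s) (\<lambda>t s. v t s - v' t s)"
  unfolding sobolev_has_time_deriv_def
proof (intro conjI allI impI)
  fix t :: real assume t: "0 \<le> t"
  have mem: "u \<tau> \<in> sobolev L m" "v \<tau> \<in> sobolev L m" "u' \<tau> \<in> sobolev L m" "v' \<tau> \<in> sobolev L m" if "0 \<le> \<tau>" for \<tau>
    using u u' that by (auto simp: sobolev_has_time_deriv_def)
  show "(\<lambda>s. u t s - u' t s) \<in> sobolev L m" "(\<lambda>s. v t s - v' t s) \<in> sobolev L m"
    by (intro sobolev_diff mem t)+
  let ?q = "\<lambda>u v \<tau> s. (1 / (\<tau> - t)) *\<^sub>R (u \<tau> s - u t s) - v t s"
  let ?d = "?q (\<lambda>t s. u t s - u' t s) (\<lambda>t s. v t s - v' t s)"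
  have lim: "((\<lambda>\<tau>. sobolev_norm L m (?q u v \<tau>)) \<longlongrightarrow> 0) (at t within {0..})"
    "((\<lambda>\<tau>. sobolev_norm L m (?q u' v' \<tau>)) \<longlongrightarrow> 0) (at t within {0..})"
    using u u' t by (auto simp: sobolev_has_time_deriv_def)
  have "((\<lambda>\<tau>. sqrt (2 * (sobolev_norm L m (?q u v \<tau>))\<^sup>2 + 2 * (sobolev_norm L m (?q u' v' \<tau>))\<^sup>2))
      \<longlongrightarrow> sqrt (2 * 0\<^sup>2 + 2 * 0\<^sup>2)) (at t within {0..})"
    by (intro tendsto_intros lim)
  then have b0: "((\<lambda>\<tau>. sqrt (2 * (sobolev_norm L m (?q u v \<tau>))\<^sup>2 + 2 * (sobolev_norm L m (?q u' v' \<tau>))\<^sup>2))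
      \<longlongrightarrow> 0) (at t within {0..})" by (simp only: power_zero_numeral mult_zero_right add_0_left real_sqrt_zero)
  have le: "eventually (\<lambda>\<tau>. norm (sobolev_norm L m (?d \<tau>))
      \<le> sqrt (2 * (sobolev_norm L m (?q u v \<tau>))\<^sup>2 + 2 * (sobolev_norm L m (?q u' v' \<tau>))\<^sup>2)) (at t within {0..})"
    unfolding eventually_at_filter
  proof (intro always_eventually allI impI)
    fix \<tau> :: real assume "\<tau> \<in> {0..}"
    then have \<tau>: "0 \<le> \<tau>" by simp
    have q: "(\<lambda>s. (1 / (\<tau> - t)) *\<^sub>R (u \<tau> s - u t s)) \<in> sobolev L m" if "u \<tau> \<in> sobolev L m" "u t \<in> sobolev L m"
      for u :: "real \<Rightarrow> real \<Rightarrow> 'a"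
      using sobolev_lincomb(1)[OF that, of "1 / (\<tau> - t)" "- (1 / (\<tau> - t))"] by (simp add: algebra_simps)
    have "?d \<tau> = (\<lambda>s. ?q u v \<tau> s - ?q u' v' \<tau> s)" by (auto simp: algebra_simps)
    then have "(sobolev_norm L m (?d \<tau>))\<^sup>2 \<le> 2 * (sobolev_norm L m (?q u v \<tau>))\<^sup>2 + 2 * (sobolev_norm L m (?q u' v' \<tau>))\<^sup>2"
      by (simp only:) (intro sobolev_norm_diff_le sobolev_diff(1) q mem t \<tau>)
    then show "norm (sobolev_norm L m (?d \<tau>))
      \<le> sqrt (2 * (sobolev_norm L m (?q u v \<tau>))\<^sup>2 + 2 * (sobolev_norm L m (?q u' v' \<tau>))\<^sup>2)"
      by (simp add: real_le_rsqrt)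
  qed
  show "((\<lambda>\<tau>. sobolev_norm L m (?d \<tau>)) \<longlongrightarrow> 0) (at t within {0..})"
    by (rule Lim_null_comparison[OF le b0])
qed

text \<open>
  The remainder of the difference quotient depends linearly on the data, so taking weak derivatives or traces
  of it commutes with forming it.
\<close>

lemma time_deriv_remainder:
  fixes u :: "real \<Rightarrow> real \<Rightarrow> 'a::euclidean_space"
  assumes u: "sobolev_has_time_deriv L m u v" and t: "0 \<le> t" "0 \<le> \<tau>"
  defines "\<rho> \<equiv> \<lambda>s. (1 / (\<tau> - t)) *\<^sub>R (u \<tau> s - u t s) - v t s"
  shows "\<rho> \<in> sobolev L m"
    and "k \<le> m \<Longrightarrow> AE s in ivl L. weak_deriv L k \<rho> s
        = (1 / (\<tau> - t)) *\<^sub>R (weak_deriv L k (u \<tau>) s - weak_deriv L k (u t) s) - weak_deriv L k (v t) s"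
    and "k < m \<Longrightarrow> 0 < L \<Longrightarrow> s \<in> {0..L} \<Longrightarrow> sob_deriv L k \<rho> s
        = (1 / (\<tau> - t)) *\<^sub>R (sob_deriv L k (u \<tau>) s - sob_deriv L k (u t) s) - sob_deriv L k (v t) s"
proof -
  have mem: "u t \<in> sobolev L m" "u \<tau> \<in> sobolev L m" "v t \<in> sobolev L m"
    using u t by (auto simp: sobolev_has_time_deriv_def)
  let ?d = "\<lambda>s. u \<tau> s - u t s"
  note d = sobolev_diff[OF mem(2,1)]
  have \<rho>: "\<rho> = (\<lambda>s. (1 / (\<tau> - t)) *\<^sub>R ?d s + (-1) *\<^sub>R v t s)" by (simp add: \<rho>_def)
  show "\<rho> \<in> sobolev L m" unfolding \<rho> by (intro sobolev_lincomb d mem)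
  show "AE s in ivl L. weak_deriv L k \<rho> s
        = (1 / (\<tau> - t)) *\<^sub>R (weak_deriv L k (u \<tau>) s - weak_deriv L k (u t) s) - weak_deriv L k (v t) s" if k: "k \<le> m"
    using sobolev_lincomb(2)[OF d(1) mem(3) k, of "1 / (\<tau> - t)" "-1"] d(2)[OF k]
    unfolding \<rho> by eventually_elim simp
  show "sob_deriv L k \<rho> s = (1 / (\<tau> - t)) *\<^sub>R (sob_deriv L k (u \<tau>) s - sob_deriv L k (u t) s) - sob_deriv L k (v t) s"
    if "k < m" "0 < L" "s \<in> {0..L}"
    using sob_deriv_lincomb[OF d(1) mem(3) that, of "1 / (\<tau> - t)" "-1"] sob_deriv_diff[OF mem(2,1) that]
    unfolding \<rho> by simp
qed

text \<open>
  The product rule for the energy. Let \<open>V\<close> and \<open>D\<close> be the \<open>k\<close>-th weak derivatives of \<open>v t\<close> and of the remainder of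
  the difference quotient. The increment over a time step \<open>h\<close> is \<open>h (D + V)\<close>; expanding the square, everything except
  the mixed term with \<open>V\<close> is of higher order, by the Cauchy-Schwarz inequality.
\<close>

lemma sqnorm_has_time_derivative:
  fixes u :: "real \<Rightarrow> real \<Rightarrow> 'a::euclidean_space"
  assumes u: "sobolev_has_time_deriv L m u v" and t: "0 \<le> t" and k: "k \<le> m"
  shows "((\<lambda>\<tau>. sqnorm L (weak_deriv L k (u \<tau>))) has_real_derivative
      2 * integral\<^sup>L (ivl L) (\<lambda>s. weak_deriv L k (u t) s \<bullet> weak_deriv L k (v t) s)) (at t within {0..})"
proof -
  let ?W = "\<lambda>\<tau>. weak_deriv L k (u \<tau>)" and ?V = "weak_deriv L k (v t)"
  let ?\<rho> = "\<lambda>\<tau> s. (1 / (\<tau> - t)) *\<^sub>R (u \<tau> s - u t s) - v t s"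
  let ?N = "\<lambda>\<tau>. sobolev_norm L m (?\<rho> \<tau>)"
  let ?I = "integral\<^sup>L (ivl L) (\<lambda>s. ?W t s \<bullet> ?V s)"
  have W: "?W \<tau> \<in> L2_space L" if "0 \<le> \<tau>" for \<tau>
    using u that k by (auto simp: sobolev_has_time_deriv_def intro: weak_deriv)
  have V: "?V \<in> L2_space L"
    using u t k by (auto simp: sobolev_has_time_deriv_def intro: weak_deriv)
  have N: "(?N \<longlongrightarrow> 0) (at t within {0..})" using u t by (simp add: sobolev_has_time_deriv_def)
  let ?b = "\<lambda>\<tau>. \<bar>\<tau> - t\<bar> * (2 * sqnorm L ?V + 2 * (?N \<tau>)\<^sup>2) + 2 * sqrt (sqnorm L (?W t) * (?N \<tau>)\<^sup>2)"
  have "(?b \<longlongrightarrow> \<bar>t - t\<bar> * (2 * sqnorm L ?V + 2 * 0\<^sup>2) + 2 * sqrt (sqnorm L (?W t) * 0\<^sup>2)) (at t within {0..})"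
    by (intro tendsto_intros N)
  then have b0: "(?b \<longlongrightarrow> 0) (at t within {0..})"
    by (simp only: power_zero_numeral mult_zero_right mult_zero_left add_0_left real_sqrt_zero diff_self abs_zero)
  have le: "eventually (\<lambda>\<tau>. norm ((sqnorm L (?W \<tau>) - sqnorm L (?W t)) / (\<tau> - t) - 2 * ?I) \<le> ?b \<tau>) (at t within {0..})"
    unfolding eventually_at_filter
  proof (intro always_eventually allI impI)
    fix \<tau> assume ne: "\<tau> \<noteq> t" and "\<tau> \<in> {0..}"
    then have \<tau>: "0 \<le> \<tau>" by simp
    let ?h = "\<tau> - t" and ?D = "weak_deriv L k (?\<rho> \<tau>)"
    note \<rho> = time_deriv_remainder[OF u t \<tau>]
    have D: "?D \<in> L2_space L" by (intro weak_deriv(1)[OF \<rho>(1) k])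
    have DV: "(\<lambda>s. ?D s + ?V s) \<in> L2_space L" by (intro L2_space_add D V)
    have "AE s in ivl L. ?W \<tau> s = ?h *\<^sub>R (?D s + ?V s) + ?W t s"
      using \<rho>(2)[OF k] by eventually_elim (use ne in simp)
    then have "sqnorm L (?W \<tau>) = sqnorm L (\<lambda>s. ?h *\<^sub>R (?D s + ?V s) + ?W t s)"
      by (intro sqnorm_cong_AE W \<tau> t L2_space_add[OF L2_space_scaleR[OF DV]])
    also have "\<dots> = ?h\<^sup>2 * sqnorm L (\<lambda>s. ?D s + ?V s)
        + 2 * ?h * integral\<^sup>L (ivl L) (\<lambda>s. (?D s + ?V s) \<bullet> ?W t s) + sqnorm L (?W t)"
      by (rule sqnorm_lincomb[OF DV W[OF t]])
    also have "integral\<^sup>L (ivl L) (\<lambda>s. (?D s + ?V s) \<bullet> ?W t s)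
        = integral\<^sup>L (ivl L) (\<lambda>s. ?W t s \<bullet> ?D s) + ?I"
      using L2_integrable_inner[OF W[OF t] D] L2_integrable_inner[OF W[OF t] V]
      by (simp add: inner_commute[of _ "?W t _"] inner_add_right)
    finally have eq: "(sqnorm L (?W \<tau>) - sqnorm L (?W t)) / ?h - 2 * ?I
        = ?h * sqnorm L (\<lambda>s. ?D s + ?V s) + 2 * integral\<^sup>L (ivl L) (\<lambda>s. ?W t s \<bullet> ?D s)"
      using ne by (simp add: field_simps power2_eq_square)
    have ND: "sqnorm L ?D \<le> (?N \<tau>)\<^sup>2" by (rule sqnorm_weak_deriv_le[OF k])
    have "\<bar>integral\<^sup>L (ivl L) (\<lambda>s. ?W t s \<bullet> ?D s)\<bar> \<le> sqrt (sqnorm L (?W t) * (?N \<tau>)\<^sup>2)"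
    proof (rule real_le_rsqrt)
      have "\<bar>integral\<^sup>L (ivl L) (\<lambda>s. ?W t s \<bullet> ?D s)\<bar>\<^sup>2 \<le> sqnorm L (?W t) * sqnorm L ?D"
        using L2_Cauchy_Schwarz[OF W[OF t] D] by simp
      also have "\<dots> \<le> sqnorm L (?W t) * (?N \<tau>)\<^sup>2"
        by (intro mult_left_mono ND sqnorm_nonneg)
      finally show "\<bar>integral\<^sup>L (ivl L) (\<lambda>s. ?W t s \<bullet> ?D s)\<bar>\<^sup>2 \<le> sqnorm L (?W t) * (?N \<tau>)\<^sup>2" .
    qed
    moreover have "\<bar>?h * sqnorm L (\<lambda>s. ?D s + ?V s)\<bar> \<le> \<bar>?h\<bar> * (2 * sqnorm L ?V + 2 * (?N \<tau>)\<^sup>2)"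
    proof -
      have "sqnorm L (\<lambda>s. ?D s + ?V s) \<le> 2 * sqnorm L ?V + 2 * (?N \<tau>)\<^sup>2"
        using sqnorm_add_le[OF D V] ND by linarith
      then show ?thesis
        using sqnorm_nonneg[of L "\<lambda>s. ?D s + ?V s"] unfolding abs_mult by (intro mult_left_mono) auto
    qed
    ultimately show "norm ((sqnorm L (?W \<tau>) - sqnorm L (?W t)) / ?h - 2 * ?I) \<le> ?b \<tau>"
      unfolding eq real_norm_def by linarith
  qed
  have "((\<lambda>\<tau>. (sqnorm L (?W \<tau>) - sqnorm L (?W t)) / (\<tau> - t) - 2 * ?I) \<longlongrightarrow> 0) (at t within {0..})"
    by (rule Lim_null_comparison[OF le b0])
  then show ?thesis
    unfolding has_field_derivative_iff by (rule Lim_null[THEN iffD2])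
qed

text \<open>
  The two kinds of limit of the same difference quotients, in \<open>L\<^sup>2\<close> and pointwise, agree because a
  sequence converging in \<open>L\<^sup>2\<close> has a subsequence converging almost everywhere.
\<close>

lemma time_deriv_eq_pointwise:
  fixes u :: "real \<Rightarrow> real \<Rightarrow> 'a::euclidean_space"
  assumes u: "sobolev_has_time_deriv L m u v" and t: "0 \<le> t"
    and d: "\<And>s. s \<in> {0<..<L} \<Longrightarrow> ((\<lambda>\<tau>. u \<tau> s) has_vector_derivative d s) (at t)"
  shows "AE s in ivl L. v t s = d s"
proof -
  let ?h = "\<lambda>n. inverse (real (Suc n))"
  let ?\<rho> = "\<lambda>\<tau> s. (1 / (\<tau> - t)) *\<^sub>R (u \<tau> s - u t s) - v t s"
  let ?q = "\<lambda>n. ?\<rho> (t + ?h n)"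
  have pos: "?h n > 0" for n by simp
  have nn: "0 \<le> t + ?h n" for n using pos[of n] t by linarith
  note \<rho> = time_deriv_remainder[OF u t nn]
  have h0: "filterlim (\<lambda>n. t + ?h n) (at t within {0..}) sequentially"
    unfolding filterlim_at
  proof (intro conjI always_eventually allI)
    show "(\<lambda>n. t + ?h n) \<longlonglongrightarrow> t"
      using tendsto_add[OF tendsto_const LIMSEQ_inverse_real_of_nat, of t] by simp
    show "t + ?h n \<in> {0..}" "t + ?h n \<noteq> t" for n using nn[of n] pos[of n] by auto
  qed
  have L2: "?q n \<in> L2_space L" for n by (rule sobolev_imp_L2[OF \<rho>(1)])
  have sq: "sqnorm L (?q n) \<le> (sobolev_norm L m (?q n))\<^sup>2" for n
  proof -
    have "sqnorm L (?q n) = sqnorm L (weak_deriv L 0 (?q n))"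
      using weak_deriv_AE_eq[OF has_weak_deriv_0 L2[of n]] 
      by (intro sqnorm_cong_AE L2) auto
    also have "\<dots> \<le> (sobolev_norm L m (?q n))\<^sup>2" by (rule sqnorm_weak_deriv_le) simp
    finally show ?thesis .
  qed
  have "((\<lambda>\<tau>. sobolev_norm L m (?\<rho> \<tau>)) \<longlongrightarrow> 0) (at t within {0..})"
    using u t by (simp add: sobolev_has_time_deriv_def)
  from filterlim_compose[OF this h0]
  have "(\<lambda>n. (sobolev_norm L m (?q n))\<^sup>2) \<longlonglongrightarrow> 0\<^sup>2" by (intro tendsto_intros)
  then have sn: "(\<lambda>n. (sobolev_norm L m (?q n))\<^sup>2) \<longlonglongrightarrow> 0" by (simp only: power_zero_numeral)
  have ev: "eventually (\<lambda>n. norm (sqnorm L (?q n)) \<le> (sobolev_norm L m (?q n))\<^sup>2) sequentially"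
    unfolding real_norm_def abs_of_nonneg[OF sqnorm_nonneg] by (intro always_eventually allI sq)
  from Lim_null_comparison[OF ev sn] have "(\<lambda>n. sqnorm L (?q n)) \<longlonglongrightarrow> 0" .
  then have "(\<lambda>n. integral\<^sup>L (ivl L) (\<lambda>s. norm ((norm (?q n s))\<^sup>2))) \<longlonglongrightarrow> 0"
    by (simp add: sqnorm_def)
  from tendsto_L1_AE_subseq[OF L2_integrable_sqnorm[OF L2] this]
  obtain r :: "nat \<Rightarrow> nat" where r: "strict_mono r" "AE s in ivl L. (\<lambda>n. (norm (?q (r n) s))\<^sup>2) \<longlonglongrightarrow> 0" by auto
  have "AE s in ivl L. s \<in> {0<..<L}" by (rule AE_I2) simp
  with r(2) show ?thesis
  proof eventually_elim
    case (elim s)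
    have "((\<lambda>\<tau>. (1 / (\<tau> - t)) *\<^sub>R (u \<tau> s - u t s)) \<longlongrightarrow> d s) (at t)"
    proof (rule LIM_zero_cancel, rule tendsto_norm_zero_cancel)
      have "((\<lambda>\<tau>. norm (u \<tau> s - u t s - (\<tau> - t) *\<^sub>R d s) / norm (\<tau> - t)) \<longlongrightarrow> 0) (at t)"
        using d[OF elim(2)] unfolding has_vector_derivative_def has_derivative_iff_norm by simp
      moreover have "eventually (\<lambda>\<tau>. norm (u \<tau> s - u t s - (\<tau> - t) *\<^sub>R d s) / norm (\<tau> - t)
          = norm ((1 / (\<tau> - t)) *\<^sub>R (u \<tau> s - u t s) - d s)) (at t)"
        unfolding eventually_at_filter
      proof (intro always_eventually allI impI)
        fix \<tau> assume "\<tau> \<noteq> t"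
        then have "(1 / (\<tau> - t)) *\<^sub>R (u \<tau> s - u t s) - d s = (1 / (\<tau> - t)) *\<^sub>R (u \<tau> s - u t s - (\<tau> - t) *\<^sub>R d s)"
          by (simp add: scaleR_diff_right)
        then show "norm (u \<tau> s - u t s - (\<tau> - t) *\<^sub>R d s) / norm (\<tau> - t)
          = norm ((1 / (\<tau> - t)) *\<^sub>R (u \<tau> s - u t s) - d s)" by simp
      qed
      ultimately show "((\<lambda>\<tau>. norm ((1 / (\<tau> - t)) *\<^sub>R (u \<tau> s - u t s) - d s)) \<longlongrightarrow> 0) (at t)"
        by (rule Lim_transform_eventually)
    qed
    moreover have "filterlim (\<lambda>n. t + ?h (r n)) (at t) sequentially"
      using filterlim_compose[OF h0 filterlim_subseq[OF r(1)]]
      by (rule filterlim_mono) (auto simp: at_le)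
    ultimately have "(\<lambda>n. (1 / (t + ?h (r n) - t)) *\<^sub>R (u (t + ?h (r n)) s - u t s)) \<longlonglongrightarrow> d s"
      by (rule filterlim_compose)
    then have "(\<lambda>n. (norm (?q (r n) s))\<^sup>2) \<longlonglongrightarrow> (norm (d s - v t s))\<^sup>2"
      by (intro tendsto_intros)
    with elim(1) have "(norm (d s - v t s))\<^sup>2 = 0"
      by (rule LIMSEQ_unique[rotated])
    then show ?case by simp
  qed
qed

text \<open>
  Compare the value at \<open>s0\<close> with the value at an arbitrary \<open>s\<close> by the fundamental theorem of calculus,
  and average over \<open>s\<close>.
\<close>

lemma sob_deriv_trace_le:
  fixes f :: "real \<Rightarrow> 'a::euclidean_space"
  assumes f: "f \<in> sobolev L (Suc m)" and L: "0 < L" and s0: "s0 \<in> {0..L}"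
  shows "(norm (sob_deriv L m f s0))\<^sup>2 \<le> (2 / L + 2 * L) * (sobolev_norm L (Suc m) f)\<^sup>2"
proof -
  let ?f = "sob_deriv L m f" and ?g = "weak_deriv L (Suc m) f"
  let ?I = "integral\<^sup>L (ivl L) (\<lambda>s. norm (?g s))" and ?N = "sobolev_norm L (Suc m) f"
  have g: "?g \<in> L2_space L" by (rule weak_deriv[OF f order_refl])
  have F: "continuous_on {0..L} ?f" "AE s in ivl L. ?f s = weak_deriv L m f s"
    using sob_deriv[OF f _ L] by auto
  have bound: "(norm (?f s0))\<^sup>2 \<le> 2 * (norm (?f s))\<^sup>2 + 2 * ?I\<^sup>2" if s: "s \<in> {0..L}" for s
  proof -
    have "?f s0 - ?f s = prim L ?g s0 - prim L ?g s"
      using sob_deriv(4)[OF f _ L s, of m] sob_deriv(4)[OF f _ L s0, of m] by simp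
    then have "norm (?f s0 - ?f s) \<le> ?I"
      using norm_prim_diff[OF L2_space_integrable[OF g], of s0 s] by simp
    then have "norm (?f s0) \<le> norm (?f s) + ?I"
      using norm_triangle_sub[of "?f s0" "?f s"] by linarith
    then have "(norm (?f s0))\<^sup>2 \<le> (norm (?f s) + ?I)\<^sup>2" by (intro power_mono) auto
    then show ?thesis using sum_squares_bound[of "norm (?f s)" ?I] by (simp add: power2_sum)
  qed
  have "L * (norm (?f s0))\<^sup>2 = integral\<^sup>L (ivl L) (\<lambda>s. (norm (?f s0))\<^sup>2)"
    using measure_ivl[OF L] by simp
  also have "\<dots> \<le> integral\<^sup>L (ivl L) (\<lambda>s. 2 * (norm (?f s))\<^sup>2 + 2 * ?I\<^sup>2)"
    using bound by (intro integral_mono integrable_ivl_continuous continuous_intros F) auto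
  also have "\<dots> = 2 * sqnorm L ?f + L * (2 * ?I\<^sup>2)"
    unfolding sqnorm_def using measure_ivl[OF L]
      integrable_ivl_continuous[OF continuous_on_power[OF continuous_on_norm[OF F(1)]], of 2]
      integrable_ivl_continuous[OF continuous_on_const, of L "2 * ?I\<^sup>2"]
    by (subst Bochner_Integration.integral_add) auto
  also have "\<dots> \<le> 2 * ?N\<^sup>2 + L * (2 * (L * ?N\<^sup>2))"
  proof -
    have "sqnorm L ?f = sqnorm L (weak_deriv L m f)"
      by (rule sqnorm_cong_AE[OF L2_space_continuous[OF F(1)] weak_deriv(1)[OF f] F(2)]) simp
    then have 1: "sqnorm L ?f \<le> ?N\<^sup>2" using sqnorm_weak_deriv_le[of m "Suc m" L f] by simp
    have "?I\<^sup>2 \<le> L * sqnorm L ?g" by (rule integral_norm_square_le[OF g L])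
    also have "\<dots> \<le> L * ?N\<^sup>2" using L by (intro mult_left_mono sqnorm_weak_deriv_le) auto
    finally show ?thesis using L 1 by (intro add_mono mult_left_mono) auto
  qed
  finally show ?thesis using L by (simp add: field_simps)
qed

text \<open>
  Traces are continuous with respect to the Sobolev norm, so a boundary condition that is constant in time can be
  differentiated in time.
\<close>

lemma time_deriv_boundary:
  fixes u :: "real \<Rightarrow> real \<Rightarrow> 'a::euclidean_space"
  assumes u: "sobolev_has_time_deriv L (Suc m) u v" and t: "0 < t" and L: "0 < L" and s0: "s0 \<in> {0..L}"
    and const: "\<And>\<tau>. 0 < \<tau> \<Longrightarrow> sob_deriv L m (u \<tau>) s0 = c"
  shows "sob_deriv L m (v t) s0 = 0"
proof -
  let ?\<rho> = "\<lambda>\<tau> s. (1 / (\<tau> - t)) *\<^sub>R (u \<tau> s - u t s) - v t s"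
  let ?N = "\<lambda>\<tau>. sobolev_norm L (Suc m) (?\<rho> \<tau>)"
  have "(?N \<longlongrightarrow> 0) (at t within {0..})" using u t by (simp add: sobolev_has_time_deriv_def)
  then have "((\<lambda>\<tau>. (2 / L + 2 * L) * (?N \<tau>)\<^sup>2) \<longlongrightarrow> (2 / L + 2 * L) * 0\<^sup>2) (at t within {0..})"
    by (intro tendsto_intros)
  then have lim: "((\<lambda>\<tau>. (2 / L + 2 * L) * (?N \<tau>)\<^sup>2) \<longlongrightarrow> 0) (at t)"
    using t by (simp add: at_within_interior[of t "{0..}"])
  have "eventually (\<lambda>\<tau>. (norm (sob_deriv L m (v t) s0))\<^sup>2 \<le> (2 / L + 2 * L) * (?N \<tau>)\<^sup>2) (at t)"
  proof -
    have "eventually (\<lambda>\<tau>. \<tau> > 0) (at t)"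
      by (rule eventually_at_in_open'[of "{0<..}", simplified]) (use t in auto)
    then show ?thesis
    proof eventually_elim
      case (elim \<tau>)
      note \<rho> = time_deriv_remainder[OF u, of t \<tau>]
      have "sob_deriv L m (?\<rho> \<tau>) s0 = - sob_deriv L m (v t) s0"
        using \<rho>(3)[of m s0] t elim const L s0 by simp
      with sob_deriv_trace_le[OF \<rho>(1) L s0] t elim show ?case by simp
    qed
  qed
  from tendsto_le[OF _ lim tendsto_const this] have "(norm (sob_deriv L m (v t) s0))\<^sup>2 \<le> 0" by simp
  then show ?thesis by simp
qed

section \<open>Uniqueness of smooth solutions\<close>

text \<open>
  The function \<open>exp (- K t) E t\<close> is nonincreasing and starts at zero.
\<close>

lemma gronwall_zero:
  fixes E E' :: "real \<Rightarrow> real"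
  assumes d: "\<And>t. 0 \<le> t \<Longrightarrow> (E has_real_derivative E' t) (at t within {0..})"
    and le: "\<And>t. 0 < t \<Longrightarrow> E' t \<le> K * E t"
    and E: "E 0 = 0" "\<And>t. 0 \<le> t \<Longrightarrow> 0 \<le> E t" and t: "0 \<le> t"
  shows "E t = 0"
proof (cases "t = 0")
  case False
  with t have t: "0 < t" by simp
  let ?G = "\<lambda>t. exp (- K * t) * E t"
  have "?G t \<le> ?G 0"
  proof (rule DERIV_nonpos_imp_decreasing_open[OF less_imp_le[OF t]])
    fix x assume x: "0 < x" "x < t"
    have "(E has_real_derivative E' x) (at x)"
      using d[of x] x by (simp add: at_within_interior[of x "{0..}"])
    then have "(?G has_real_derivative (exp (- K * x) * (E' x - K * E x))) (at x)"
      by (auto intro!: derivative_eq_intros simp: algebra_simps)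
    moreover have "exp (- K * x) * (E' x - K * E x) \<le> 0"
      using le[OF x(1)] by (simp add: mult_le_0_iff)
    ultimately show "\<exists>y. (?G has_real_derivative y) (at x) \<and> y \<le> 0" by blast
  next
    have "continuous_on {0..} E" 
      by (rule DERIV_continuous_on[OF d]) simp
    then show "continuous_on {0..t} ?G"
      by (intro continuous_intros) (auto intro: continuous_on_subset)
  qed
  with E(1) have "exp (- K * t) * E t \<le> 0" by simp
  then show ?thesis using E(2)[of t] t by (simp add: mult_le_0_iff)
qed (use E in simp)

interpretation cross3: bounded_bilinear cross3
  using bilinear_cross by (simp add: bilinear_conv_bounded_bilinear)

lemma norm_cross3_le: "norm (cross3 x y) \<le> norm x * norm y"
proof (rule power2_le_imp_le)
  show "(norm (cross3 x y))\<^sup>2 \<le> (norm x * norm y)\<^sup>2"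
    using norm_cross[of x y] by (simp add: power_mult_distrib)
qed simp

text \<open>
  The scalar formula is applied to each coordinate.
\<close>

lemma inner_integration_by_parts_prim:
  fixes f f' g G :: "real \<Rightarrow> 'a::euclidean_space"
  assumes d: "\<And>s. s \<in> {0..L} \<Longrightarrow> (f has_vector_derivative f' s) (at s within {0..L})"
    and f': "continuous_on {0..L} f'" and g: "integrable (ivl L) g" and L: "0 < L"
    and G: "\<And>s. s \<in> {0..L} \<Longrightarrow> G s = G 0 + prim L g s"
  shows "integral\<^sup>L (ivl L) (\<lambda>s. f' s \<bullet> G s) + integral\<^sup>L (ivl L) (\<lambda>s. f s \<bullet> g s)
    = f L \<bullet> G L - f 0 \<bullet> G 0"
proof -
  have f: "continuous_on {0..L} f" by (meson continuous_on_vector_derivative d)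
  have "continuous_on {0..L} (\<lambda>s. G 0 + prim L g s)"
    by (intro continuous_intros continuous_prim g)
  then have cG: "continuous_on {0..L} G"
    by (rule continuous_on_eq) (use G in metis)
  have parts: "integral\<^sup>L (ivl L) (\<lambda>s. (f' s \<bullet> i) *\<^sub>R (G s \<bullet> i)) + integral\<^sup>L (ivl L) (\<lambda>s. (f s \<bullet> i) *\<^sub>R (g s \<bullet> i))
      = (f L \<bullet> i) *\<^sub>R (G L \<bullet> i) - (f 0 \<bullet> i) *\<^sub>R (G 0 \<bullet> i)" for i
  proof (rule integration_by_parts_prim[OF _ _ _ L])
    show "((\<lambda>s. f s \<bullet> i) has_vector_derivative f' s \<bullet> i) (at s within {0..L})" if "s \<in> {0..L}" for s
      by (rule bounded_linear.has_vector_derivative[OF bounded_linear_inner_left d[OF that]])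
    show "continuous_on {0..L} (\<lambda>s. f' s \<bullet> i)" by (intro continuous_intros f')
    show "integrable (ivl L) (\<lambda>s. g s \<bullet> i)" using g by simp
    fix s assume s: "s \<in> {0..L}"
    have "prim L (\<lambda>s. g s \<bullet> i) s = prim L g s \<bullet> i"
      unfolding prim_def using integrable_ivl_indicator[OF g, of "{..s}"]
      by (subst integral_inner_left[symmetric]) simp_all
    then show "G s \<bullet> i = G 0 \<bullet> i + prim L (\<lambda>s. g s \<bullet> i) s"
      using G[OF s] by (simp add: inner_add_left)
  qed
  have int1: "integrable (ivl L) (\<lambda>s. (f' s \<bullet> i) * (G s \<bullet> i))" for i
    by (intro integrable_ivl_continuous continuous_intros f' cG)
  have int2: "integrable (ivl L) (\<lambda>s. (f s \<bullet> i) * (g s \<bullet> i))" for i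
    using integrable_ivl_scaleR_continuous[of L "\<lambda>s. f s \<bullet> i" "\<lambda>s. g s \<bullet> i"] g
    by (simp add: continuous_on_inner f)
  have "integral\<^sup>L (ivl L) (\<lambda>s. f' s \<bullet> G s) + integral\<^sup>L (ivl L) (\<lambda>s. f s \<bullet> g s)
      = (\<Sum>i\<in>Basis. integral\<^sup>L (ivl L) (\<lambda>s. (f' s \<bullet> i) * (G s \<bullet> i)) + integral\<^sup>L (ivl L) (\<lambda>s. (f s \<bullet> i) * (g s \<bullet> i)))"
    by (subst (1 2) euclidean_inner) (simp add: int1 int2 sum.distrib)
  also have "\<dots> = (\<Sum>i\<in>Basis. (f L \<bullet> i) * (G L \<bullet> i) - (f 0 \<bullet> i) * (G 0 \<bullet> i))"
    using parts by simp
  also have "\<dots> = f L \<bullet> G L - f 0 \<bullet> G 0"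
    by (subst (3 4) euclidean_inner) (simp add: sum_subtractf)
  finally show ?thesis .
qed

text \<open>
  A function vanishing at \<open>0\<close> is bounded by the \<open>L\<^sup>1\<close> norm of its derivative, hence by the \<open>L\<^sup>2\<close> norm.
\<close>

lemma poincare:
  fixes f :: "real \<Rightarrow> 'a::euclidean_space"
  assumes f: "\<And>s. s \<in> {0..L} \<Longrightarrow> f s = prim L g s" and g: "g \<in> L2_space L" and L: "0 < L"
  shows "sqnorm L f \<le> L\<^sup>2 * sqnorm L g"
proof -
  let ?I = "integral\<^sup>L (ivl L) (\<lambda>s. norm (g s))"
  have "norm (f s) \<le> ?I" if "s \<in> {0..L}" for s
    using norm_prim_diff[OF L2_space_integrable[OF g], of s 0] f[OF that] by simp
  then have "(norm (f s))\<^sup>2 \<le> ?I\<^sup>2" if "s \<in> {0..L}" for s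
    using that by (intro power_mono) auto
  moreover have "continuous_on {0..L} f"
    by (rule continuous_on_eq[OF continuous_prim[OF L2_space_integrable[OF g]]]) (use f in auto)
  ultimately have "sqnorm L f \<le> integral\<^sup>L (ivl L) (\<lambda>s. ?I\<^sup>2)"
    unfolding sqnorm_def by (intro integral_mono integrable_ivl_continuous continuous_intros) auto
  also have "\<dots> = L * ?I\<^sup>2" using measure_ivl[OF L] by simp
  also have "\<dots> \<le> L * (L * sqnorm L g)"
    using L by (intro mult_left_mono integral_norm_square_le g) auto
  finally show ?thesis by (simp add: power2_eq_square)
qed

text \<open>
  The heart of uniqueness. Here \<open>y\<close> is the state of an arbitrary solution and \<open>X 0\<close> the state of a smooth one at the same time,
  \<open>w\<close> is their difference, and \<open>v\<close> its time derivative. Energies of the difference of two solutions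
  of \<open>x\<^sub>t = x\<^sub>s \<times> x\<^sub>s\<^sub>s\<close> usually lose a derivative. At the level of \<open>w\<^sub>s\<^sub>s\<close> they do not:
  \<open>v\<^sub>s = w\<^sub>s \<times> X\<^sub>s\<^sub>s\<^sub>s + y\<^sub>s \<times> w\<^sub>s\<^sub>s\<^sub>s\<close>, because the terms with \<open>w\<^sub>s\<^sub>s\<close> cancel, so after one integration by parts
  the product \<open>w\<^sub>s\<^sub>s\<^sub>s \<bullet> v\<^sub>s\<close> contains the third derivative of \<open>w\<close> only linearly, and a second
  integration by parts moves it onto the smooth \<open>X\<close>. What remains is
  \<open>w\<^sub>s\<^sub>s \<bullet> (w\<^sub>s \<times> X\<^sub>s\<^sub>s\<^sub>s\<^sub>s)\<close>, which Poincare's inequality bounds by the energy itself.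
  The boundary terms vanish since \<open>w\<^sub>s\<close> and \<open>v\<^sub>s\<close> vanish at both ends.
\<close>

lemma energy_estimate:
  fixes y v :: "real \<Rightarrow> real^3" and X :: "nat \<Rightarrow> real \<Rightarrow> real^3"
  assumes y: "y \<in> sobolev L 4" and X: "deriv_chain L X" and v: "v \<in> sobolev L 2" and L: "0 < L"
  defines "w \<equiv> \<lambda>s. y s - X 0 s"
  assumes eq: "AE s in ivl L. v s = cross3 (sob_deriv L 1 y s) (sob_deriv L 2 y s) - cross3 (X 1 s) (X 2 s)"
    and w0: "\<And>s. s \<in> {0, L} \<Longrightarrow> sob_deriv L 1 w s = 0"
    and v0: "\<And>s. s \<in> {0, L} \<Longrightarrow> sob_deriv L 1 v s = 0"
    and B: "\<And>s. s \<in> {0..L} \<Longrightarrow> norm (X 4 s) \<le> B"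
  shows "2 * integral\<^sup>L (ivl L) (\<lambda>s. weak_deriv L 2 w s \<bullet> weak_deriv L 2 v s)
    \<le> B * (1 + L\<^sup>2) * sqnorm L (weak_deriv L 2 w)"
proof -
  have X0: "X 0 \<in> sobolev L 4" by (rule deriv_chain_sobolev(1)[OF X L])
  have w: "w \<in> sobolev L 4" unfolding w_def by (rule sobolev_diff(1)[OF y X0])
  let ?W = "\<lambda>k. sob_deriv L k w" and ?Y = "\<lambda>k. sob_deriv L k y" and ?V = "\<lambda>k. sob_deriv L k v"
  let ?V2 = "weak_deriv L 2 v"
  have W: "?W k s = ?Y k s - X k s" if "k < 4" "s \<in> {0..L}" for k s
    unfolding w_def using sob_deriv_diff[OF y X0 that(1) L that(2)] deriv_chain_sobolev(4)[OF X L that(2)] by simp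
  have cW: "continuous_on {0..L} (?W k)" and cY: "continuous_on {0..L} (?Y k)" if "k < 4" for k
    using sob_deriv(1)[OF w that L] sob_deriv(1)[OF y that L] by auto
  have cX: "continuous_on {0..L} (X k)" for k by (rule deriv_chain_continuous[OF X])
  have cV: "continuous_on {0..L} (?V k)" if "k < 2" for k by (rule sob_deriv(1)[OF v that L])
  have dW: "(?W k has_vector_derivative ?W (Suc k) s) (at s within {0..L})"
    and dY: "(?Y k has_vector_derivative ?Y (Suc k) s) (at s within {0..L})" if "Suc k < 4" "s \<in> {0..L}" for k s
    using sob_deriv_has_vector_derivative[OF w that(1) L that(2)]
      sob_deriv_has_vector_derivative[OF y that(1) L that(2)] by auto
  have dX: "(X k has_vector_derivative X (Suc k) s) (at s within {0..L})" if "s \<in> {0..L}" for k s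
    using X that by (simp add: deriv_chain_def)
  let ?d = "\<lambda>s. cross3 (?W 1 s) (X 2 s) + cross3 (?Y 1 s) (?W 2 s)"
  have V0: "?V 0 s = ?d s" if s: "s \<in> {0..L}" for s
  proof (rule continuous_on_AE_unique[OF cV _ _ s L])
    show "continuous_on {0..L} ?d" by (intro continuous_intros continuous_on_cross cW cX cY) auto
    have "AE s in ivl L. ?V 0 s = v s"
      using sob_deriv(2)[OF v _ L, of 0] weak_deriv_AE_eq(2)[OF has_weak_deriv_0 sobolev_imp_L2[OF v]] by auto
    moreover have "AE s in ivl L. s \<in> {0..L}" by (rule AE_I2) auto
    ultimately show "AE s in ivl L. ?V 0 s = ?d s"
      using eq
    proof eventually_elim
      case (elim s)
      then show ?case
        using W[of 1 s] W[of 2 s] by (simp add: cross3.diff_left cross3.diff_right)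
    qed
  qed simp
  have V1: "?V 1 s = cross3 (?W 1 s) (X 3 s) + cross3 (?Y 1 s) (?W 3 s)" if s: "s \<in> {0..L}" for s
  proof -
    have "(?V 0 has_vector_derivative ?V 1 s) (at s within {0..L})"
      using sob_deriv_has_vector_derivative[OF v _ L s, of 0] by simp
    then have 1: "(?d has_vector_derivative ?V 1 s) (at s within {0..L})"
      by (rule has_vector_derivative_transform[OF s, rotated]) (simp add: V0)
    have "(?d has_vector_derivative (cross3 (?W 1 s) (X 3 s) + cross3 (?W 2 s) (X 2 s))
        + (cross3 (?Y 1 s) (?W 3 s) + cross3 (?Y 2 s) (?W 2 s))) (at s within {0..L})"
      using dW[OF _ s, of 1] dW[OF _ s, of 2] dY[OF _ s, of 1] dX[OF s, of 2]
      by (intro has_vector_derivative_add cross3.has_vector_derivative) (simp_all add: eval_nat_numeral)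
    then have "?V 1 s = (cross3 (?W 1 s) (X 3 s) + cross3 (?W 2 s) (X 2 s))
        + (cross3 (?Y 1 s) (?W 3 s) + cross3 (?Y 2 s) (?W 2 s))"
      using vector_derivative_unique_within_closed_interval[of 0 L s] 1 s L by simp
    \<comment> \<open>The terms with the second derivative of \<open>w\<close> cancel.\<close>
    also have "?Y 2 s = ?W 2 s + X 2 s" using W[of 2 s] s by simp
    finally show ?thesis using cross_skew[of "X 2 s" "?W 2 s"] by (simp add: cross3.add_left)
  qed
  have V2: "?V2 \<in> L2_space L" by (rule weak_deriv[OF v order_refl])
  have p1: "integral\<^sup>L (ivl L) (\<lambda>s. ?W 3 s \<bullet> ?V 1 s) + integral\<^sup>L (ivl L) (\<lambda>s. ?W 2 s \<bullet> ?V2 s)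
      = ?W 2 L \<bullet> ?V 1 L - ?W 2 0 \<bullet> ?V 1 0"
  proof (rule inner_integration_by_parts_prim[OF _ _ L2_space_integrable[OF V2] L])
    show "?V 1 s = ?V 1 0 + prim L ?V2 s" if "s \<in> {0..L}" for s
      using sob_deriv(4)[OF v _ L that, of 1] by (simp add: numeral_2_eq_2)
    show "(?W 2 has_vector_derivative ?W 3 s) (at s within {0..L})" if "s \<in> {0..L}" for s
      using dW[OF _ that, of 2] by (simp add: eval_nat_numeral)
  qed (auto intro: cW)
  let ?G = "\<lambda>s. cross3 (?W 1 s) (X 3 s)" and ?G' = "\<lambda>s. cross3 (?W 1 s) (X 4 s) + cross3 (?W 2 s) (X 3 s)"
  have cG': "continuous_on {0..L} ?G'" by (intro continuous_intros continuous_on_cross cW cX) auto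
  have dG: "(?G has_vector_derivative ?G' s) (at s within {0..L})" if s: "s \<in> {0..L}" for s
    using dW[OF _ s, of 1] dX[OF s, of 3]
    by (intro cross3.has_vector_derivative) (simp_all add: eval_nat_numeral)
  have p2: "integral\<^sup>L (ivl L) (\<lambda>s. ?W 3 s \<bullet> ?G s) + integral\<^sup>L (ivl L) (\<lambda>s. ?W 2 s \<bullet> ?G' s)
      = ?W 2 L \<bullet> ?G L - ?W 2 0 \<bullet> ?G 0"
  proof (rule inner_integration_by_parts_prim[OF _ _ _ L])
    show "?G s = ?G 0 + prim L ?G' s" if "s \<in> {0..L}" for s
      using prim_of_derivative[OF dG cG' that] by simp
    show "(?W 2 has_vector_derivative ?W 3 s) (at s within {0..L})" if "s \<in> {0..L}" for s
      using dW[OF _ that, of 2] by (simp add: eval_nat_numeral)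
    show "integrable (ivl L) ?G'" by (rule integrable_ivl_continuous[OF cG'])
  qed (auto intro: cW)
  \<comment> \<open>The term with \<open>?W 3\<close> in \<open>?V 1\<close> is orthogonal to \<open>?W 3\<close>; in the same way the term with \<open>?W 2\<close>
    in \<open>?G'\<close> is orthogonal to \<open>?W 2\<close>.\<close>
  have "integral\<^sup>L (ivl L) (\<lambda>s. ?W 3 s \<bullet> ?V 1 s) = integral\<^sup>L (ivl L) (\<lambda>s. ?W 3 s \<bullet> ?G s)"
  proof (rule Bochner_Integration.integral_cong[OF refl])
    fix s assume "s \<in> space (ivl L)"
    then have "s \<in> {0..L}" by simp
    from V1[OF this] show "?W 3 s \<bullet> ?V 1 s = ?W 3 s \<bullet> ?G s"
      by (simp only: inner_add_right dot_cross_self add_0_right)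
  qed
  moreover have "integral\<^sup>L (ivl L) (\<lambda>s. ?W 2 s \<bullet> ?G' s) = integral\<^sup>L (ivl L) (\<lambda>s. ?W 2 s \<bullet> cross3 (?W 1 s) (X 4 s))"
    by (simp add: inner_add_right dot_cross_self)
  ultimately have id: "integral\<^sup>L (ivl L) (\<lambda>s. ?W 2 s \<bullet> ?V2 s)
      = integral\<^sup>L (ivl L) (\<lambda>s. ?W 2 s \<bullet> cross3 (?W 1 s) (X 4 s))"
    using p1 p2 v0 w0 by simp
  have pt: "2 * (?W 2 s \<bullet> cross3 (?W 1 s) (X 4 s)) \<le> B * ((norm (?W 2 s))\<^sup>2 + (norm (?W 1 s))\<^sup>2)"
    if s: "s \<in> {0..L}" for s
  proof -
    have B0: "0 \<le> B" using B[OF s] norm_ge_zero order_trans by blast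
    have "?W 2 s \<bullet> cross3 (?W 1 s) (X 4 s) \<le> norm (?W 2 s) * norm (cross3 (?W 1 s) (X 4 s))"
      by (rule norm_cauchy_schwarz)
    also have "\<dots> \<le> norm (?W 2 s) * (norm (?W 1 s) * B)"
      by (intro mult_left_mono order_trans[OF norm_cross3_le] B s) auto
    finally have "2 * (?W 2 s \<bullet> cross3 (?W 1 s) (X 4 s)) \<le> B * (2 * norm (?W 2 s) * norm (?W 1 s))"
      by (simp add: algebra_simps)
    also have "\<dots> \<le> B * ((norm (?W 2 s))\<^sup>2 + (norm (?W 1 s))\<^sup>2)"
      by (intro mult_left_mono sum_squares_bound B0)
    finally show ?thesis .
  qed
  have B0: "0 \<le> B" using order_trans[OF norm_ge_zero B[of 0]] L by simp
  have ae: "AE s in ivl L. weak_deriv L 2 w s = ?W 2 s"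
    using sob_deriv(2)[OF w _ L, of 2] by auto
  have W2: "?W 2 \<in> L2_space L" by (intro L2_space_continuous cW) simp
  have sqW: "sqnorm L (weak_deriv L 2 w) = sqnorm L (?W 2)"
    by (rule sqnorm_cong_AE[OF _ W2 ae]) (simp add: weak_deriv(1)[OF w])
  have W1: "?W 1 s = prim L (weak_deriv L 2 w) s" if "s \<in> {0..L}" for s
    using sob_deriv(4)[OF w _ L that, of 1] w0[of 0] by (simp add: eval_nat_numeral)
  have int: "integrable (ivl L) (\<lambda>s. (norm (?W 1 s))\<^sup>2)" "integrable (ivl L) (\<lambda>s. (norm (?W 2 s))\<^sup>2)"
    by (intro integrable_ivl_continuous continuous_intros cW; simp)+
  have "2 * integral\<^sup>L (ivl L) (\<lambda>s. weak_deriv L 2 w s \<bullet> ?V2 s) = 2 * integral\<^sup>L (ivl L) (\<lambda>s. ?W 2 s \<bullet> ?V2 s)"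
    using ae weak_deriv(1)[OF w, of 2]
    by (intro arg_cong[where f="(*) 2"] integral_cong_AE borel_measurable_integrable L2_integrable_inner V2 W2) auto
  also have "\<dots> = integral\<^sup>L (ivl L) (\<lambda>s. 2 * (?W 2 s \<bullet> cross3 (?W 1 s) (X 4 s)))"
    unfolding id by simp
  also have "\<dots> \<le> integral\<^sup>L (ivl L) (\<lambda>s. B * ((norm (?W 2 s))\<^sup>2 + (norm (?W 1 s))\<^sup>2))"
    using pt by (intro integral_mono integrable_ivl_continuous continuous_intros continuous_on_cross cW cX) auto
  also have "\<dots> = B * (sqnorm L (?W 2) + sqnorm L (?W 1))"
    unfolding sqnorm_def using int by simp
  also have "\<dots> \<le> B * (sqnorm L (?W 2) + L\<^sup>2 * sqnorm L (weak_deriv L 2 w))"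
    using weak_deriv(1)[OF w, of 2]
    by (intro mult_left_mono add_left_mono poincare[OF W1] B0 L) auto
  finally show ?thesis by (simp add: sqW algebra_simps)
qed

text \<open>
  By the energy estimate and Gronwall's lemma, \<open>w\<^sub>s\<^sub>s\<close> vanishes for all times; then so does \<open>w\<^sub>s\<close>, which vanishes at the
  boundary, and the equation gives \<open>w\<^sub>t = 0\<close>. The initial condition enters through continuity in time
  with values in \<open>L\<^sup>2\<close>, because the equation is imposed pointwise only for positive times.
\<close>

lemma smooth_solution_unique:
  fixes x y :: "real \<Rightarrow> real \<Rightarrow> real^3" and X :: "real \<Rightarrow> nat \<Rightarrow> real \<Rightarrow> real^3"
  assumes x: "solves_P R \<theta> \<phi> x" and y: "solves_P R \<theta> \<phi> y" and L: "0 < \<theta> * R"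
    and X: "\<And>t. deriv_chain (\<theta> * R) (X t)" "\<And>t. (\<lambda>s. x s t) = X t 0"
    and B: "\<And>t s. 0 \<le> t \<Longrightarrow> s \<in> {0..\<theta> * R} \<Longrightarrow> norm (X t 4 s) \<le> B"
    and s: "s \<in> {0<..<\<theta> * R}" and t: "0 \<le> t"
  shows "y s t = x s t"
proof -
  define L where "L = \<theta> * R"
  note L = L[folded L_def] and X = X[folded L_def] and B = B[folded L_def] and s = s[folded L_def]
  note x = x[unfolded solves_P_def Let_def, folded L_def] and y = y[unfolded solves_P_def Let_def, folded L_def]
  define w where "w = (\<lambda>t s. y s t - x s t)"
  have mem: "(\<lambda>s. y s t) \<in> sobolev L 4" "(\<lambda>s. x s t) \<in> sobolev L 4" if "0 \<le> t" for t
    using x y that spec[OF conjunct1[OF conjunct2[OF x]], of 0] spec[OF conjunct1[OF conjunct2[OF y]], of 0]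
    by (auto simp: C0_sobolev_def)
  have "Cj_sobolev 1 L 2 (\<lambda>t s. x s t)" "Cj_sobolev 1 L 2 (\<lambda>t s. y s t)"
    using spec[OF conjunct1[OF conjunct2[OF x]], of 1] spec[OF conjunct1[OF conjunct2[OF y]], of 1] by simp_all
  then obtain vx vy where "sobolev_has_time_deriv L 2 (\<lambda>t s. x s t) vx" "sobolev_has_time_deriv L 2 (\<lambda>t s. y s t) vy"
    by auto
  then have v: "sobolev_has_time_deriv L 2 w (\<lambda>t s. vy t s - vx t s)"
    unfolding w_def by (intro sobolev_has_time_deriv_diff)
  define v where "v = (\<lambda>t s. vy t s - vx t s)"
  note v = v[folded v_def]
  let ?Y = "\<lambda>k t. sob_deriv L k (\<lambda>s. y s t)"
  have w4: "w t \<in> sobolev L 4" if "0 \<le> t" for t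
    unfolding w_def by (intro sobolev_diff(1) mem that)
  have w2: "w t \<in> sobolev L 2" and v2: "v t \<in> sobolev L 2" if "0 \<le> t" for t
    using v that by (auto simp: sobolev_has_time_deriv_def)
  have sX: "sob_deriv L k (\<lambda>s. x s t) s = X t k s" if "s \<in> {0..L}" for k s t
    unfolding X(2) by (rule deriv_chain_sobolev(4)[OF X(1) L that])
  have wX: "w t = (\<lambda>s. y s t - X t 0 s)" for t
    using fun_cong[OF X(2)[of t]] by (auto simp: w_def)
  have W: "sob_deriv L k (w t) s = ?Y k t s - X t k s" if "k < 4" "s \<in> {0..L}" "0 \<le> t" for k s t
    unfolding w_def using sob_deriv_diff[OF mem(1,2)[OF that(3)] that(1) L that(2)] sX[OF that(2)] by simp
  have w0: "sob_deriv L 1 (w t) s = 0" if "s \<in> {0, L}" "0 < t" for s t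
    unfolding w_def using sob_deriv_diff[OF mem(1,2)[of t], of 1 s] L that x y by auto
  have v0: "sob_deriv L 1 (v t) s = 0" if "s \<in> {0, L}" "0 < t" for s t
  proof -
    have "sobolev_has_time_deriv L (Suc 1) w v" using v by (simp add: eval_nat_numeral)
    then show ?thesis using that w0 L by (intro time_deriv_boundary[of L 1 w v t s 0]) auto
  qed
  have d: "((\<lambda>\<tau>. w \<tau> s) has_vector_derivative
      cross3 (?Y 1 t s) (?Y 2 t s) - cross3 (X t 1 s) (X t 2 s)) (at t)"
    if "s \<in> {0<..<L}" "0 < t" for s t
  proof -
    have "((\<lambda>\<tau>. y s \<tau> - x s \<tau>) has_vector_derivative
        cross3 (?Y 1 t s) (?Y 2 t s)
        - cross3 (sob_deriv L 1 (\<lambda>s. x s t) s) (sob_deriv L 2 (\<lambda>s. x s t) s)) (at t)"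
      using x y that by (intro has_vector_derivative_diff) auto
    then show ?thesis using that by (simp add: w_def sX)
  qed
  define E where "E = (\<lambda>t. sqnorm L (weak_deriv L 2 (w t)))"
  \<comment> \<open>The initial states agree only on the open interval; weak derivatives do not see the endpoints.\<close>
  have "w 0 s = 0" if "s \<in> {0<..<L}" for s
    using x y that by (simp add: w_def)
  then have init: "sqnorm L (weak_deriv L k (w 0)) = 0" if "k \<le> 2" for k
  proof -
    have "deriv_chain L (\<lambda>_ _. 0 :: real^3)" by (simp add: deriv_chain_def)
    note z = deriv_chain_sobolev[OF this L]
    have "weak_deriv L k (w 0) = weak_deriv L k (\<lambda>_. 0)"
      using w2[of 0] z(1)[of 0] \<open>\<And>s. s \<in> {0<..<L} \<Longrightarrow> w 0 s = 0\<close>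
      by (intro weak_deriv_cong_AE sobolev_imp_L2 AE_I2) auto
    then have "sqnorm L (weak_deriv L k (w 0)) = sqnorm L (\<lambda>_. 0 :: real^3)"
      by (simp only: sqnorm_cong_AE[OF z(3) L2_space_continuous[OF continuous_on_const] z(2)])
    then show ?thesis by (simp add: sqnorm_def)
  qed
  have E0: "E t = 0" if "0 \<le> t" for t
  proof (rule gronwall_zero[OF _ _ _ _ that])
    show "(E has_real_derivative 2 * integral\<^sup>L (ivl L) (\<lambda>s. weak_deriv L 2 (w t) s \<bullet> weak_deriv L 2 (v t) s)) (at t within {0..})"
      if "0 \<le> t" for t
      unfolding E_def by (rule sqnorm_has_time_derivative[OF v that order_refl])
    show "2 * integral\<^sup>L (ivl L) (\<lambda>s. weak_deriv L 2 (w t) s \<bullet> weak_deriv L 2 (v t) s) \<le> (B * (1 + L\<^sup>2)) * E t"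
      if "0 < t" for t
      unfolding E_def wX
    proof (rule energy_estimate[OF _ X(1) _ L])
      show "AE s in ivl L. v t s = cross3 (?Y 1 t s) (?Y 2 t s) - cross3 (X t 1 s) (X t 2 s)"
        using that by (intro time_deriv_eq_pointwise[OF v] d) auto
    qed (use that mem v2 w0 v0 B wX in auto)
    show "E 0 = 0" unfolding E_def by (rule init) simp
  qed (simp add: E_def sqnorm_nonneg)
  have W0: "sob_deriv L k (w t) s = 0" if k: "k \<in> {1, 2}" and s: "s \<in> {0..L}" and t: "0 < t" for k s t
  proof -
    note c = sob_deriv(1)[OF w4[OF less_imp_le[OF t]] _ L]
    have "AE s in ivl L. weak_deriv L 2 (w t) s = 0"
      using E0[of t] t L2_integrable_sqnorm[OF weak_deriv(1)[OF w2, of t 2]]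
      by (simp add: E_def sqnorm_def integral_nonneg_eq_0_iff_AE)
    then have z: "prim L (weak_deriv L 2 (w t)) s = 0" for s
      using prim_cong_AE[OF L2_space_integrable[OF weak_deriv(1)[OF w2]] , of t 2 "\<lambda>_. 0" s] t
      by (simp add: prim_def)
    have W1: "sob_deriv L 1 (w t) s = 0" if "s \<in> {0..L}" for s
      using sob_deriv(4)[OF w2 _ L that, of t 1] z w0[of 0 t] t by (simp add: eval_nat_numeral)
    have "(sob_deriv L 1 (w t) has_vector_derivative sob_deriv L 2 (w t) s) (at s within {0..L})"
      using sob_deriv_has_vector_derivative[OF w4 _ L s, of t 1] t by (simp add: eval_nat_numeral)
    moreover have "(sob_deriv L 1 (w t) has_vector_derivative 0) (at s within {0..L})"
      by (rule has_vector_derivative_transform[OF s W1]) auto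
    ultimately have "sob_deriv L 2 (w t) s = 0"
      using vector_derivative_unique_within_closed_interval[of 0 L s] s L by simp
    with W1 s k show ?thesis by auto
  qed
  have const: "w \<tau> s = w t s" if "0 < \<tau>" "0 < t" "s \<in> {0<..<L}" for \<tau> t s
  proof (rule has_derivative_zero_unique_connected[of "{0<..}" "\<lambda>\<tau>. w \<tau> s"])
    fix t :: real assume "t \<in> {0<..}"
    then have t: "0 < t" by simp
    have "?Y k t s = X t k s" if "k \<in> {1, 2}" for k
      using W[of k s t] W0[OF that, of s t] that t \<open>s \<in> {0<..<L}\<close> by auto
    then have "((\<lambda>\<tau>. w \<tau> s) has_vector_derivative 0) (at t)"
      using d[OF \<open>s \<in> {0<..<L}\<close> t] by simp
    then show "((\<lambda>\<tau>. w \<tau> s) has_derivative (\<lambda>x. 0)) (at t)"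
      by (simp add: has_vector_derivative_def)
  qed (use that in auto)
  show ?thesis
  proof (cases "t = 0")
    case True
    then show ?thesis using x y s by simp
  next
    case False
    with t have t: "0 < t" by simp
    let ?e = "\<lambda>t. sqnorm L (weak_deriv L 0 (w t))"
    have e: "?e \<tau> = ?e t" if "0 < \<tau>" for \<tau>
    proof -
      have "AE s in ivl L. w \<tau> s = w t s"
        by (rule AE_I2) (use const[OF that t] in simp)
      then have "weak_deriv L 0 (w \<tau>) = weak_deriv L 0 (w t)"
        using that t by (intro weak_deriv_cong_AE sobolev_imp_L2[OF w2]) auto
      then show ?thesis by simp
    qed
    have "continuous (at 0 within {0..}) ?e"
      by (rule DERIV_continuous[OF sqnorm_has_time_derivative[OF v]]) auto
    then have "(?e \<longlongrightarrow> 0) (at 0 within {0..})"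
      using init[of 0] by (simp add: continuous_within)
    moreover have "eventually (\<lambda>\<tau>. ?e \<tau> = ?e t) (at 0 within {0..})"
      unfolding eventually_at_filter by (intro always_eventually allI impI e) auto
    ultimately have "((\<lambda>_. ?e t) \<longlongrightarrow> 0) (at (0::real) within {0..})"
      by (rule Lim_transform_eventually)
    moreover have "at (0::real) within {0..} \<noteq> bot" by (simp add: trivial_limit_at_right_real at_within_Ici_at_right)
    ultimately have "?e t = 0" by (simp add: tendsto_const_iff)
    moreover have "?e t = sqnorm L (w t)"
      using weak_deriv_AE_eq[OF has_weak_deriv_0 sobolev_imp_L2[OF w2], of t] t
      by (intro sqnorm_cong_AE sobolev_imp_L2[OF w2]) auto
    ultimately have "AE s in ivl L. w t s = 0"
      using L2_integrable_sqnorm[OF sobolev_imp_L2[OF w2, of t]] t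
      by (simp add: sqnorm_def integral_nonneg_eq_0_iff_AE)
    moreover have "continuous_on {0..L} (w t)"
      unfolding w_def using x y t by (intro continuous_intros) auto
    ultimately have "w t s = 0"
      using s L by (intro continuous_on_AE_unique[of L "w t" "\<lambda>_. 0"]) auto
    then show ?thesis by (simp add: w_def)
  qed
qed

section \<open>Circular filaments\<close>

definition dir :: "real \<Rightarrow> real^3" where
  "dir a = vector [cos a, sin a, 0]"

lemma inner_vector_3: "x \<bullet> vector [a, b, c] = x $ 1 * a + x $ 2 * b + x $ 3 * c" for x :: "real^3"
  by (simp add: inner_vec_def sum_3)

lemma norm_dir: "norm (dir a) = 1"
  by (simp add: norm_eq_sqrt_inner dir_def inner_vector_3 flip: power2_eq_square)

lemma dir_periodic: "dir (a + 2 * pi * real n) = dir a"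
proof -
  have "cos (2 * pi * real n) = 1" "sin (2 * pi * real n) = 0"
    by (intro cos_integer_2pi sin_integer_2pi; simp)+
  then show ?thesis unfolding dir_def cos_add sin_add by (simp only: mult_1_right mult_zero_right diff_zero add_0_right)
qed

lemma dir_add_pi: "dir (a + pi) = - dir a"
  by (simp add: dir_def vec_eq_iff forall_3)

lemma dir_has_vector_derivative: "(dir has_vector_derivative dir (a + pi / 2)) (at a within S)"
proof -
  have eq: "dir = (\<lambda>a. cos a *\<^sub>R axis 1 1 + sin a *\<^sub>R axis 2 1)"
    by (auto simp: dir_def vec_eq_iff forall_3 axis_def)
  have "(dir has_vector_derivative (- sin a) *\<^sub>R axis 1 1 + cos a *\<^sub>R axis 2 1) (at a within S)"
    unfolding eq by (auto intro!: derivative_eq_intros)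
  moreover have "(- sin a) *\<^sub>R axis 1 1 + cos a *\<^sub>R axis 2 1 = dir (a + pi / 2)"
    by (auto simp: dir_def vec_eq_iff forall_3 axis_def cos_add sin_add)
  ultimately show ?thesis by simp
qed

text \<open>
  The \<open>k\<close>-th arc length derivative, at time \<open>t\<close>, of the filament of radius \<open>r\<close>: each differentiation turns the
  direction by a right angle and divides by \<open>r\<close>.
\<close>

definition circ :: "real \<Rightarrow> real \<Rightarrow> nat \<Rightarrow> real \<Rightarrow> real^3" where
  "circ r t k s = (r / r ^ k) *\<^sub>R dir (s / r + real k * (pi / 2)) + (if k = 0 then (t / r) *\<^sub>R axis 3 1 else 0)"

lemma deriv_chain_circ:
  assumes r: "r > 0" shows "deriv_chain L (circ r t)"
  unfolding deriv_chain_def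
proof (intro allI ballI)
  fix k s
  have "((\<lambda>s. s / r + real k * (pi / 2)) has_real_derivative 1 / r) (at s within {0..L})"
    using r by (auto intro!: derivative_eq_intros)
  then have "((\<lambda>s. dir (s / r + real k * (pi / 2))) has_vector_derivative
      (1 / r) *\<^sub>R dir (s / r + real k * (pi / 2) + pi / 2)) (at s within {0..L})"
    using vector_diff_chain_within[OF _ dir_has_vector_derivative, of "\<lambda>s. s / r + real k * (pi / 2)" "1 / r" s "{0..L}"]
    by (simp add: has_real_derivative_iff_has_vector_derivative o_def)
  then have "((\<lambda>s. (r / r ^ k) *\<^sub>R dir (s / r + real k * (pi / 2)) + (if k = 0 then (t / r) *\<^sub>R axis 3 1 else 0))
      has_vector_derivative (r / r ^ k) *\<^sub>R (1 / r) *\<^sub>R dir (s / r + real k * (pi / 2) + pi / 2) + 0) (at s within {0..L})"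
    by (intro has_vector_derivative_add bounded_linear.has_vector_derivative[OF bounded_linear_scaleR_right]
        has_vector_derivative_const)
  moreover have "circ r t k = (\<lambda>s. (r / r ^ k) *\<^sub>R dir (s / r + real k * (pi / 2)) + (if k = 0 then (t / r) *\<^sub>R axis 3 1 else 0))"
    by (intro ext) (simp only: circ_def)
  moreover have "circ r t (Suc k) s = (r / r ^ k) *\<^sub>R (1 / r) *\<^sub>R dir (s / r + real k * (pi / 2) + pi / 2) + 0"
  proof -
    have "s / r + real (Suc k) * (pi / 2) = s / r + real k * (pi / 2) + pi / 2" by (simp add: algebra_simps)
    then show ?thesis unfolding circ_def by (simp only: scaleR_scaleR) (simp add: field_simps)
  qed
  ultimately show "(circ r t k has_vector_derivative circ r t (Suc k) s) (at s within {0..L})"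
    by (simp only:)
qed

lemma norm_circ: "r > 0 \<Longrightarrow> k > 0 \<Longrightarrow> norm (circ r t k s) = r / r ^ k"
  by (simp add: circ_def norm_dir)

lemma circ_eq_arc_filament: "circ r t 0 s = arc_filament r s t"
  by (simp add: circ_def dir_def arc_filament_def vec_eq_iff forall_3 axis_def)

lemma circ_eq_arc_filament0: "circ r 0 0 s = arc_filament0 r s"
  by (simp add: circ_def dir_def arc_filament0_def vec_eq_iff forall_3 axis_def)

lemma circ_1: "r > 0 \<Longrightarrow> circ r t 1 s = dir (s / r + pi / 2)"
  by (simp add: circ_def)

text \<open>
  The right-hand side of the equation along a circular filament. It is a constant vertical vector, so the circle
  moves by translation, with speed \<open>1 / r\<close>.
\<close>

lemma circ_cross:
  assumes "r > 0" shows "cross3 (circ r t 1 s) (circ r t 2 s) = (1 / r) *\<^sub>R axis 3 1"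
proof -
  have "cross3 (dir (a + pi / 2)) (dir (a + pi)) = axis 3 1" for a
    by (simp add: dir_def cross3_def vec_eq_iff forall_3 axis_def cos_add sin_add flip: power2_eq_square)
  then show ?thesis using assms
    by (simp add: circ_def cross_mult_left cross_mult_right power2_eq_square)
qed

lemma circ_cross_13: "cross3 (circ r t 1 s) (circ r t 3 s) = 0"
proof -
  have "s / r + 3 * (pi / 2) = s / r + pi / 2 + pi" by simp
  then have "dir (s / r + 3 * (pi / 2)) = - dir (s / r + pi / 2)"
    by (simp only: dir_add_pi)
  then show ?thesis by (simp add: circ_def cross_mult_left cross_mult_right)
qed

text \<open>
  A circular arc of length \<open>L\<close> cannot be told from one with \<open>n\<close> additional full turns by the tangents at its ends.
\<close>

lemma circ_endpoints:
  assumes r: "r > 0" and ang: "L / r = \<theta> + 2 * pi * real n"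
  shows "circ r t 1 0 = e2" "circ r t 1 L = b_vec \<theta>"
proof -
  show "circ r t 1 0 = e2" using r by (simp add: circ_def dir_def e2_def)
  have "circ r t 1 L = dir (\<theta> + pi / 2 + 2 * pi * real n)"
    unfolding circ_1[OF r] using ang by (simp add: algebra_simps)
  then show "circ r t 1 L = b_vec \<theta>"
    unfolding dir_periodic by (simp add: dir_def b_vec_def cos_add sin_add)
qed

lemma deriv_chain_const: "deriv_chain L (\<lambda>k s. if k = 0 then c else 0)"
  unfolding deriv_chain_def by auto

lemma sobolev_norm_const:
  fixes c :: "'a::euclidean_space"
  assumes L: "0 < L" shows "sobolev_norm L m (\<lambda>s. c) = sqrt L * norm c"
proof -
  have "(\<Sum>k\<le>m. sqnorm L (\<lambda>s. if k = 0 then c else 0)) = sqnorm L (\<lambda>s. c)"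
    by (subst sum.remove[of _ 0]) (auto simp: sqnorm_def)
  also have "\<dots> = L * (norm c)\<^sup>2" using measure_ivl[OF L] by (simp add: sqnorm_def)
  finally show ?thesis
    using deriv_chain_sobolev_norm[OF deriv_chain_const L, of m c] by (simp add: real_sqrt_mult)
qed

section \<open>Translations as functions of time\<close>

lemma const_sobolev: "0 < L \<Longrightarrow> (\<lambda>s. c) \<in> sobolev L m" for c :: "'a::euclidean_space"
  using deriv_chain_sobolev(1)[OF deriv_chain_const, of L c m] by simp

lemma C0_sobolev_translation:
  fixes f :: "real \<Rightarrow> 'a::euclidean_space"
  assumes f: "f \<in> sobolev L m" and L: "0 < L"
  shows "C0_sobolev L m (\<lambda>t s. f s + t *\<^sub>R c)"
  unfolding C0_sobolev_def
proof (intro conjI allI impI)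
  fix t :: real
  show "(\<lambda>s. f s + t *\<^sub>R c) \<in> sobolev L m"
    using sobolev_lincomb(1)[OF f const_sobolev[OF L], of 1 1 "t *\<^sub>R c"] by simp
  have "(\<lambda>s. (f s + \<tau> *\<^sub>R c) - (f s + t *\<^sub>R c)) = (\<lambda>s. (\<tau> - t) *\<^sub>R c)" for \<tau>
    by (auto simp: algebra_simps)
  moreover have "((\<lambda>\<tau>. sqrt L * norm ((\<tau> - t) *\<^sub>R c)) \<longlongrightarrow> sqrt L * norm ((t - t) *\<^sub>R c)) (at t within {0..})"
    by (intro tendsto_intros)
  ultimately show "((\<lambda>\<tau>. sobolev_norm L m (\<lambda>s. (f s + \<tau> *\<^sub>R c) - (f s + t *\<^sub>R c))) \<longlongrightarrow> 0) (at t within {0..})"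
    by (simp add: sobolev_norm_const[OF L])
qed

lemma sobolev_has_time_deriv_translation:
  fixes f :: "real \<Rightarrow> 'a::euclidean_space"
  assumes f: "f \<in> sobolev L m" and L: "0 < L"
  shows "sobolev_has_time_deriv L m (\<lambda>t s. f s + t *\<^sub>R c) (\<lambda>t s. c)"
  unfolding sobolev_has_time_deriv_def
proof (intro conjI allI impI)
  fix t :: real
  show "(\<lambda>s. f s + t *\<^sub>R c) \<in> sobolev L m"
    using sobolev_lincomb(1)[OF f const_sobolev[OF L], of 1 1 "t *\<^sub>R c"] by simp
  show "(\<lambda>s. c) \<in> sobolev L m" by (rule const_sobolev[OF L])
  have "eventually (\<lambda>\<tau>. 0 = sobolev_norm L m
      (\<lambda>s. (1 / (\<tau> - t)) *\<^sub>R ((f s + \<tau> *\<^sub>R c) - (f s + t *\<^sub>R c)) - c)) (at t within {0..})"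
    unfolding eventually_at_filter
  proof (intro always_eventually allI impI)
    fix \<tau> assume "\<tau> \<noteq> t"
    then have "(1 / (\<tau> - t)) *\<^sub>R ((f s + \<tau> *\<^sub>R c) - (f s + t *\<^sub>R c)) - c = 0" for s
      by (simp flip: scaleR_diff_left)
    then show "0 = sobolev_norm L m (\<lambda>s. (1 / (\<tau> - t)) *\<^sub>R ((f s + \<tau> *\<^sub>R c) - (f s + t *\<^sub>R c)) - c)"
      using sobolev_norm_const[OF L, of m "0::'a"] by simp
  qed
  then show "((\<lambda>\<tau>. sobolev_norm L m (\<lambda>s. (1 / (\<tau> - t)) *\<^sub>R ((f s + \<tau> *\<^sub>R c) - (f s + t *\<^sub>R c)) - c)) \<longlongrightarrow> 0)
      (at t within {0..})"
    by (rule Lim_transform_eventually[OF tendsto_const])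
qed

text \<open>
  The time derivative of a translation with constant velocity is again one, with velocity zero.
\<close>

lemma Cj_sobolev_translation:
  fixes f :: "real \<Rightarrow> 'a::euclidean_space"
  assumes f: "f \<in> sobolev L m" and L: "0 < L"
  shows "Cj_sobolev j L m (\<lambda>t s. f s + t *\<^sub>R c)"
  using f
proof (induction j arbitrary: f c)
  case (Suc j)
  have "Cj_sobolev j L m (\<lambda>t s. (\<lambda>s. c) s + t *\<^sub>R 0)"
    by (rule Suc.IH[OF const_sobolev[OF L]])
  then show ?case
    using C0_sobolev_translation[OF Suc.prems L, of c] sobolev_has_time_deriv_translation[OF Suc.prems L, of c] by auto
qed (simp add: C0_sobolev_translation L)

lemma sobolev_cong_AE:
  assumes f: "f \<in> sobolev L m" and g: "g \<in> L2_space L" and ae: "AE s in ivl L. f s = g s"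
  shows "g \<in> sobolev L m"
proof -
  have "has_weak_deriv L k g (weak_deriv L k f)" if "k \<le> m" for k
    by (rule has_weak_deriv_cong_AE[OF weak_deriv(2)[OF f that] _ _ ae])
      (intro L2_space_integrable sobolev_imp_L2[OF f] g weak_deriv(1)[OF f that] AE_I2 refl)+
  then show ?thesis using g weak_deriv(1)[OF f] unfolding sobolev_def by blast
qed

text \<open>
  Functions of time are compared here as functions of \<open>s\<close>, not as classes modulo null sets; so the constant
  simple function with value \<open>h\<close> approximates \<open>g\<close> although the values of \<open>g\<close> may vary within the class of \<open>h\<close>.
\<close>

lemma Linf_sobolev_AE_const:
  fixes g :: "real \<Rightarrow> real \<Rightarrow> 'a::euclidean_space"
  assumes L: "0 < L" and h: "h \<in> sobolev L m"
    and g: "\<And>t. 0 < t \<Longrightarrow> g t \<in> L2_space L" "\<And>t. 0 < t \<Longrightarrow> AE s in ivl L. h s = g t s"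
  shows "Linf_sobolev L m g"
proof -
  have gm: "g t \<in> sobolev L m" if "0 < t" for t
    by (rule sobolev_cong_AE[OF h g(1)[OF that] g(2)[OF that]])
  have N: "sobolev_norm L m (g t) = sobolev_norm L m h" if "0 < t" for t
    by (rule sobolev_norm_cong_AE[OF sobolev_imp_L2[OF h] g(1)[OF that] g(2)[OF that], symmetric])
  have Z: "sobolev_norm L m (\<lambda>s. h s - g t s) = 0" if "0 < t" for t
  proof -
    have "sobolev_norm L m (\<lambda>s. h s - g t s) = sobolev_norm L m (\<lambda>s. 0::'a)"
      using g(2)[OF that]
      by (intro sobolev_norm_cong_AE L2_space_diff sobolev_imp_L2[OF h] g(1) that
          L2_space_continuous continuous_on_const) auto
    then show ?thesis using sobolev_norm_const[OF L, of m "0::'a"] by simp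
  qed
  let ?S = "\<lambda>(n::nat) (t::real). h"
  have "finite (?S n ` {0<..})" "?S n ` {0<..} \<subseteq> sobolev L m" "{t \<in> {0<..}. ?S n t = f} \<in> sets lebesgue" for n f
    using h by (auto intro: finite_subset[of _ "{h}"])
  moreover have "AE t in lebesgue_on {0<..}. (\<lambda>n. sobolev_norm L m (\<lambda>s. ?S n t s - g t s)) \<longlonglongrightarrow> 0"
    using Z by (intro AE_I2) simp
  moreover have "AE t in lebesgue_on {0<..}. g t \<in> sobolev L m \<and> sobolev_norm L m (g t) \<le> sobolev_norm L m h"
    using gm N by (intro AE_I2) simp
  ultimately show ?thesis
    unfolding Linf_sobolev_def by (intro conjI exI[of _ ?S] exI[of _ "sobolev_norm L m h"]) auto
qed

lemma circ_solves_P: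
  assumes r: "r > 0" and L: "0 < \<theta> * R" and ang: "\<theta> * R / r = \<theta> + 2 * pi * real n"
  shows "solves_P R \<theta> (\<lambda>s. circ r 0 0 s - circ R 0 0 s) (\<lambda>s t. circ r t 0 s)"
proof -
  define L where "L = \<theta> * R"
  note L = L[folded L_def]
  note C = deriv_chain_circ[OF r, of L]
  have D: "sob_deriv L k (circ r t 0) s = circ r t k s" if "s \<in> {0..L}" for k t s
    by (rule deriv_chain_sobolev(4)[OF C L that])
  have tr: "(\<lambda>t. circ r t 0) = (\<lambda>t s. circ r 0 0 s + t *\<^sub>R ((1 / r) *\<^sub>R axis 3 1))"
    by (intro ext) (simp add: circ_def)
  have "Cj_sobolev j L m (\<lambda>t. circ r t 0)" for j m
    unfolding tr by (intro Cj_sobolev_translation deriv_chain_sobolev(1)[OF C] L)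
  moreover have "Linf_sobolev L 3 (\<lambda>t. weak_deriv L 1 (circ r t 0))"
  proof (rule Linf_sobolev_AE_const[OF L])
    show "circ r 0 1 \<in> sobolev L 3"
      using deriv_chain_sobolev(1)[OF deriv_chain_shift[OF deriv_chain_circ[OF r], where j=1] L] by simp
    fix t
    show "weak_deriv L 1 (circ r t 0) \<in> L2_space L" by (rule deriv_chain_sobolev(3)[OF C L])
    have "circ r t 1 = circ r 0 1" by (auto simp: circ_def)
    then show "AE s in ivl L. circ r 0 1 s = weak_deriv L 1 (circ r t 0) s"
      using deriv_chain_sobolev(2)[OF C L, of 1 t] by auto
  qed
  moreover have "((\<lambda>\<tau>. circ r \<tau> 0 s) has_vector_derivative cross3 (circ r t 1 s) (circ r t 2 s)) (at t)" for s t
  proof -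
    have "(\<lambda>\<tau>. circ r \<tau> 0 s) = (\<lambda>\<tau>. r *\<^sub>R dir (s / r) + \<tau> *\<^sub>R ((1 / r) *\<^sub>R axis 3 1))"
      by (intro ext) (simp add: circ_def)
    then show ?thesis
      unfolding circ_cross[OF r] using r by (auto intro!: derivative_eq_intros)
  qed
  moreover note circ_endpoints[OF r ang[folded L_def]]
  ultimately show ?thesis
    unfolding solves_P_def Let_def L_def[symmetric]
    using L deriv_chain_continuous[OF C] by (auto simp: D circ_eq_arc_filament0 simp del: One_nat_def)
qed


section \<open>Filaments with additional turns\<close>

theorem theorem2p6:
  fixes R \<theta> :: real
  assumes "R > 0" and "\<theta> \<in> {0<..<pi}"
  shows "\<exists>\<phi> :: nat \<Rightarrow> real \<Rightarrow> real^3. \<forall>n\<ge>1.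
           \<phi> n \<in> sobolev (\<theta> * R) 4 \<and> continuous_on {0..\<theta> * R} (\<phi> n) \<and>
           cond_A1 R \<theta> (\<phi> n) \<and> cond_A2 R \<theta> (\<phi> n) \<and> cond_A3 R \<theta> (\<phi> n) \<and>
           (\<exists>x. is_the_solution R \<theta> (\<phi> n) x \<and>
              (\<forall>s\<in>{0<..<\<theta> * R}. \<forall>t\<ge>0.
                 \<bar>x s t $ 3 - arc_filament R s t $ 3\<bar> = (2 * pi * real n / (R * \<theta>)) * t))"
proof -
  define L where "L = \<theta> * R"
  have R: "R > 0" and \<theta>: "\<theta> > 0" and L: "L > 0" using assms by (auto simp: L_def)
  \<comment> \<open>The radius for which an arc of length \<open>L\<close> subtends the angle \<open>\<theta> + 2 \<pi> n\<close>.\<close>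
  define r where "r n = L / (\<theta> + 2 * pi * real n)" for n
  define \<phi> where "\<phi> n s = circ (r n) 0 0 s - circ R 0 0 s" for n s
  have "\<phi> n \<in> sobolev L 4 \<and> continuous_on {0..L} (\<phi> n) \<and>
      cond_A1 R \<theta> (\<phi> n) \<and> cond_A2 R \<theta> (\<phi> n) \<and> cond_A3 R \<theta> (\<phi> n) \<and>
      (\<exists>x. is_the_solution R \<theta> (\<phi> n) x \<and>
         (\<forall>s\<in>{0<..<L}. \<forall>t\<ge>0. \<bar>x s t $ 3 - arc_filament R s t $ 3\<bar> = (2 * pi * real n / (R * \<theta>)) * t))" for n
  proof -
    have pos: "\<theta> + 2 * pi * real n > 0" using \<theta> by (intro add_pos_nonneg) auto
    have r: "r n > 0" using L pos by (simp add: r_def)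
    have ang: "L / r n = \<theta> + 2 * pi * real n" using L pos by (simp add: r_def)
    note C = deriv_chain_circ[OF r, of L] and CR = deriv_chain_circ[OF R, of L]
    have \<phi>: "\<phi> n = (\<lambda>k s. circ (r n) 0 k s - circ R 0 k s) 0" by (auto simp: \<phi>_def)
    note D = deriv_chain_diff[OF C CR, of 0 0]
    have arc: "arc_filament0 R = circ R 0 0" by (auto simp: circ_eq_arc_filament0)
    have sum: "(\<lambda>s. arc_filament0 R s + \<phi> n s) = circ (r n) 0 0" by (auto simp: \<phi>_def arc)
    have end1: "circ (r n) t 1 0 = e2" "circ (r n) t 1 L = b_vec \<theta>" for t
      using circ_endpoints[OF r ang] by auto
    have "\<phi> n \<in> sobolev L 4" unfolding \<phi> by (rule deriv_chain_sobolev(1)[OF D L])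
    moreover have "continuous_on {0..L} (\<phi> n)" unfolding \<phi> by (rule deriv_chain_continuous[OF D])
    moreover have "cond_A1 R \<theta> (\<phi> n)"
      unfolding cond_A1_def L_def[symmetric]
    proof
      fix s assume "s \<in> {0<..<L}"
      then have s: "s \<in> {0..L}" by simp
      show "norm (sob_deriv L 1 (arc_filament0 R) s + sob_deriv L 1 (\<phi> n) s) = 1"
        unfolding arc \<phi> deriv_chain_sobolev(4)[OF CR L s] deriv_chain_sobolev(4)[OF D L s]
        using norm_circ[OF r, of 1 0 s] r by simp
    qed
    moreover have "cond_A2 R \<theta> (\<phi> n)"
    proof -
      have "sob_deriv L k (circ (r n) 0 0) s = circ (r n) 0 k s" if "s \<in> {0, L}" for k s
        using that L by (intro deriv_chain_sobolev(4)[OF C L]) auto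
      then show ?thesis
        unfolding cond_A2_def Let_def L_def[symmetric] sum using end1[of 0] circ_cross_13[of "r n" 0 0] circ_cross_13[of "r n" 0 L]
        by (simp del: One_nat_def)
    qed
    moreover have "cond_A3 R \<theta> (\<phi> n)"
    proof -
      have "b_vec \<theta> \<bullet> dir (\<theta> + 2 * pi * real n) = 0" "b_vec \<theta> \<bullet> dir \<theta> = 0"
        unfolding dir_periodic by (simp_all add: dir_def b_vec_def inner_vector_3)
      moreover have "e2 \<bullet> dir 0 = 0" by (simp add: dir_def e2_def inner_vector_3)
      moreover have "L / R = \<theta>" using R by (simp add: L_def)
      ultimately show ?thesis
        unfolding cond_A3_def L_def[symmetric] \<phi>_def by (simp add: circ_def inner_diff_right ang)
    qed
    moreover have "\<exists>x. is_the_solution R \<theta> (\<phi> n) x \<and>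
         (\<forall>s\<in>{0<..<L}. \<forall>t\<ge>0. \<bar>x s t $ 3 - arc_filament R s t $ 3\<bar> = (2 * pi * real n / (R * \<theta>)) * t)"
    proof (intro exI conjI ballI allI impI)
      have S: "solves_P R \<theta> (\<phi> n) (\<lambda>s t. circ (r n) t 0 s)"
        using circ_solves_P[OF r, of \<theta> R n] L ang unfolding L_def \<phi>_def by simp
      show "is_the_solution R \<theta> (\<phi> n) (\<lambda>s t. circ (r n) t 0 s)"
        unfolding is_the_solution_def
      proof (intro conjI allI impI ballI S)
        fix y s t assume "solves_P R \<theta> (\<phi> n) y" "s \<in> {0<..<\<theta> * R}" "0 \<le> (t::real)"
        then show "y s t = circ (r n) t 0 s"
          using L norm_circ[OF r, of 4]
          by (intro smooth_solution_unique[OF S, where X="circ (r n)" and B="r n / r n ^ 4"])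
            (auto simp: L_def intro: deriv_chain_circ[OF r])
      qed
      fix s t :: real assume t: "0 \<le> t"
      have "circ (r n) t 0 s $ 3 - arc_filament R s t $ 3 = (1 / r n - 1 / R) * t"
        by (simp add: circ_eq_arc_filament arc_filament_def algebra_simps)
      also have "1 / r n - 1 / R = 2 * pi * real n / (R * \<theta>)"
        using R \<theta> pos by (simp add: r_def L_def field_simps)
      finally show "\<bar>circ (r n) t 0 s $ 3 - arc_filament R s t $ 3\<bar> = (2 * pi * real n / (R * \<theta>)) * t"
        using R \<theta> t by simp
    qed
    ultimately show ?thesis by blast
  qed
  then show ?thesis unfolding L_def[symmetric] by blast
qed

end
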